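(* Let $N\ge 3$ be an integer. There exists a universal constant $C(N)>0$ (depending only on $N$) such that for all $u\in\mathcal{C}_0^\infty(\mathbb{R}^N\setminus\{\mathbf{0}\})\setminus\{0\}$, $$\left(\int_{\mathbb{R}^N}|\nabla u|^2\,\mathrm{d}x\right)^{\frac12}\left(\int_{\mathbb{R}^N}|u|^2\,\mathrm{d}x\right)^{\frac12}-\frac{N-1}{2}\int_{\mathbb{R}^N}\frac{|u|^2}{|x|}\,\mathrm{d}x\ge C(N)\left(\frac{\int_{\mathbb{R}^N}|\nabla u|^2\,\mathrm{d}x}{\int_{\mathbb{R}^N}|u|^2\,\mathrm{d}x}\right)^{\frac12}\inf_{c\in\mathbb{R},\,\lambda>0}\int_{\mathbb{R}^N}\left|u-c\,e^{-\frac{|x|}{\lambda}}\right|^2\,\mathrm{d}x,$$ which is equivalent to $$1-\frac{\frac{N-1}{2}\int_{\mathbb{R}^N}\frac{|u|^2}{|x|}\,\mathrm{d}x}{\left(\int_{\mathbb{R}^N}|\nabla u|^2\,\mathrm{d}x\right)^{\frac12}\left(\int_{\mathbb{R}^N}|u|^2\,\mathrm{d}x\right)^{\frac12}}\ge C(N)\inf_{v\in\mathcal{M}_{0,0}}\left(\frac{\int_{\mathbb{R}^N}|u-v|^2\,\mathrm{d}x}{\int_{\mathbb{R}^N}|u|^2\,\mathrm{d}x}\right).$$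
   Context: $\mathcal{C}_0^\infty(\mathbb{R}^N\setminus\{\mathbf{0}\})$ is the set of real-valued smooth functions compactly supported in $\mathbb{R}^N\setminus\{\mathbf{0}\}$. The set $\mathcal{M}_{0,0}$ is $\mathcal{M}_{0,0}:=\{\alpha e^{\beta|x|}:\ \alpha\in\mathbb{R},\ \beta<0\}$. *)

theory Defs
  imports "HOL-Analysis.Analysis"
begin

definition partial :: "'n::finite \<Rightarrow> (real^'n \<Rightarrow> real) \<Rightarrow> real^'n \<Rightarrow> real" where
  "partial i u x = frechet_derivative u (at x) (axis i 1)"

definition grad :: "(real^'n::finite \<Rightarrow> real) \<Rightarrow> real^'n \<Rightarrow> real^'n" where
  "grad u x = (\<chi> i. partial i u x)"

text \<open>\<open>Ck_on k S u\<close> is meant for open \<open>S\<close>. Differentiability is required explicitly, so that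
  \<^const>\<open>frechet_derivative\<close> is the actual derivative at every point of \<open>S\<close>; this is no
  loss, since continuous partial derivatives imply differentiability.\<close>

primrec Ck_on :: "nat \<Rightarrow> (real^'n::finite) set \<Rightarrow> (real^'n \<Rightarrow> real) \<Rightarrow> bool" where
  "Ck_on 0 S u \<longleftrightarrow> continuous_on S u"
| "Ck_on (Suc k) S u \<longleftrightarrow> (\<forall>x\<in>S. u differentiable at x) \<and> (\<forall>i. Ck_on k S (partial i u))"

definition smooth_on :: "(real^'n::finite) set \<Rightarrow> (real^'n \<Rightarrow> real) \<Rightarrow> bool" where
  "smooth_on S u \<longleftrightarrow> (\<forall>k. Ck_on k S u)"

text \<open>Smooth functions with compact support in the open set \<open>S\<close>, extended by zero to the
  whole space.\<close>

definition Cc_infinity :: "(real^'n::finite) set \<Rightarrow> (real^'n \<Rightarrow> real) set" where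
  "Cc_infinity S = {u. smooth_on S u \<and> compact (closure {x. u x \<noteq> 0}) \<and> closure {x. u x \<noteq> 0} \<subseteq> S}"

definition M00 :: "(real^'n::finite \<Rightarrow> real) set" where
  "M00 = {\<lambda>x. \<alpha> * exp (\<beta> * norm x) | \<alpha> \<beta>. \<beta> < 0}"

definition L2_sq :: "(real^'n::finite \<Rightarrow> real) \<Rightarrow> real" where
  "L2_sq u = (LINT x|lborel. \<bar>u x\<bar>\<^sup>2)"

definition dirichlet_energy :: "(real^'n::finite \<Rightarrow> real) \<Rightarrow> real" where
  "dirichlet_energy u = (LINT x|lborel. (norm (grad u x))\<^sup>2)"

definition coulomb_energy :: "(real^'n::finite \<Rightarrow> real) \<Rightarrow> real" where
  "coulomb_energy u = (LINT x|lborel. \<bar>u x\<bar>\<^sup>2 / norm x)"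

end

theory Submission
  imports Defs
begin

text \<open>With \<open>b = \<parallel>\<nabla>u\<parallel> / \<parallel>u\<parallel>\<close>, expanding the square and integrating the cross term by parts shows
  that the deficit equals \<open>1 / (2b)\<close> times the integral of
  \<open>|\<nabla>u + b u x/|x||\<^sup>2 = |\<nabla>w|\<^sup>2 exp(-2b|x|)\<close>, where \<open>w = u exp(b|x|)\<close>. The claim is thus a Poincare
  inequality for the measure with density \<open>exp(-2b|x|)\<close>. It is obtained by comparing \<open>w(x)\<close> with
  \<open>w((x+y)/2)\<close>: averaging over \<open>y\<close> in a ball gives a local inequality, and for \<open>y = 0\<close> the change of
  variables \<open>x \<mapsto> x/2\<close> shrinks the tail of \<open>w - c\<close> by a factor that can be absorbed.\<close>

subsection \<open>Contraction towards a point\<close>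

text \<open>The obstacle is the tail: an inequality on a ball says nothing about the mass far out.
  Doubling x = 2z turns the weight exp(-2|x|) into exp(-4|z|), so beyond radius R there is a gain
  exp(-2R), which beats the Jacobian 2^N as soon as R is comparable to N; R = N + 1 is the choice
  made. Absorbing the tail subtracts a multiple of the quantity being estimated, which therefore has
  to be finite: the estimate is first made on balls, with a bound independent of their radius, and
  the radius is sent to infinity afterwards. Comparing w(x) with a midpoint value, and not with w(y)
  itself, keeps the segment parameter t in [1/2, 1]. Along the whole segment the substitution z = t
  d would produce the factor t^(-N), singular at t = 0. No mean value is computed: c is the value of
  w at some point of the ball that does no worse than average. The exponent is not optimised either,
  since lambda = 1/b already gives the inequality.\<close>

lemma sq_le_if_am_gm:
  fixes a A :: real
  assumes "\<And>\<theta>. \<theta> > 0 \<Longrightarrow> \<bar>a\<bar> \<le> \<theta> / 2 * A + 1 / (2 * \<theta>)"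
  shows "a\<^sup>2 \<le> A"
proof (cases "a = 0")
  case True
  have "0 \<le> A"
  proof (rule ccontr)
    assume "\<not> 0 \<le> A"
    \<comment> \<open>Every sufficiently large theta refutes a negative A; this one makes the
      assumed bound equal to -(3/4) sqrt(-A) < 0.\<close>
    define \<theta> where "\<theta> = 2 / sqrt (-A)"
    have s: "sqrt (-A) > 0" "(sqrt (-A))\<^sup>2 = -A" using \<open>\<not> 0 \<le> A\<close> by auto
    have "\<theta> / 2 * A = - sqrt (-A)" "1 / (2 * \<theta>) = sqrt (-A) / 4"
      using s by (auto simp: \<theta>_def field_simps power2_eq_square)
    then show False using assms[of \<theta>] s True by (auto simp: \<theta>_def)
  qed
  then show ?thesis using True by simp
next
  case False
  \<comment> \<open>At theta = 1/|a| the assumption reads |a| \<le> A/(2|a|) + |a|/2, so half of |a|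
    can be moved to the left.\<close>
  then have "\<bar>a\<bar> * \<bar>a\<bar> \<le> (1 / \<bar>a\<bar> / 2 * A + \<bar>a\<bar> / 2) * \<bar>a\<bar>"
    using assms[of "1 / \<bar>a\<bar>"] by (intro mult_right_mono) (auto simp: field_simps)
  then show ?thesis using False by (auto simp: field_simps power2_eq_square)
qed

lemma nn_integral_affine:
  fixes f :: "'a::euclidean_space \<Rightarrow> ennreal"
  assumes [measurable]: "f \<in> borel_measurable borel" and c: "c \<noteq> 0"
  shows "(\<integral>\<^sup>+x. f x \<partial>lborel) = ennreal (\<bar>c\<bar> ^ DIM('a)) * (\<integral>\<^sup>+x. f (t + c *\<^sub>R x) \<partial>lborel)"
  by (subst lborel_affine[OF c, of t])
     (simp add: nn_integral_density nn_integral_distr nn_integral_cmult)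

lemma lborel_pair_swap:
  fixes f :: "'a::euclidean_space \<Rightarrow> 'b::euclidean_space \<Rightarrow> ennreal"
  assumes "case_prod f \<in> borel_measurable (borel \<Otimes>\<^sub>M borel)"
  shows "(\<integral>\<^sup>+ y. (\<integral>\<^sup>+ x. f x y \<partial>lborel) \<partial>lborel) = (\<integral>\<^sup>+ x. (\<integral>\<^sup>+ y. f x y \<partial>lborel) \<partial>lborel)"
  using assms by (intro lborel_pair.Fubini') simp

lemma exp_weight_has_integral:
  fixes s :: real
  shows "((\<lambda>t. s * exp (- (s * (1 - t)))) has_integral (1 - exp (- (s / 2)))) {1/2..1}"
proof -
  have "((\<lambda>t. s * exp (- (s * (1 - t)))) has_integral (exp (- (s * (1 - 1))) - exp (- (s * (1 - 1/2))))) {1/2..1}"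
    by (intro fundamental_theorem_of_calculus)
       (auto simp: has_real_derivative_iff_has_vector_derivative[symmetric] intro!: derivative_eq_intros)
  then show ?thesis by simp
qed

lemma nn_integral_exp_weight_le_1:
  fixes s :: real
  assumes "s \<ge> 0"
  shows "(\<integral>\<^sup>+t. ennreal (s * exp (- (s * (1 - t)))) * indicator {1/2..1} t \<partial>lborel) \<le> 1"
proof -
  from nn_integral_has_integral_lebesgue'[OF _ exp_weight_has_integral[of s]] show ?thesis
    using assms by (simp del: ennreal_1 add: ennreal_1[symmetric] ennreal_leI)
qed

locale C1_field =
  fixes w :: "'a::euclidean_space \<Rightarrow> real" and G :: "'a \<Rightarrow> 'a"
  assumes deriv: "\<And>x. (w has_derivative (\<lambda>h. G x \<bullet> h)) (at x)"
    and contG: "continuous_on UNIV G"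
begin

lemma cont: "continuous_on UNIV w"
  using deriv has_derivative_continuous continuous_at_imp_continuous_on by blast

lemma measurable_G [measurable]: "G \<in> borel_measurable borel"
  using contG by (rule borel_measurable_continuous_onI)

lemma measurable_w [measurable]: "w \<in> borel_measurable borel"
  using cont by (rule borel_measurable_continuous_onI)

text \<open>Cauchy-Schwarz for the integral of the directional derivative over t in [1/2, 1], with s
  = |d|: |G| s is the product of |G| sqrt(s) exp(s(1-t)/2) and sqrt(s) exp(-s(1-t)/2). The square of
  the second factor integrates to 1 - exp(-s/2) \<le> 1, so no constant depending on d
  remains.\<close>

lemma half_segment_sq_le:
  fixes y d :: 'a
  shows "ennreal ((w (y + d) - w (y + d /\<^sub>R 2))\<^sup>2)
    \<le> (\<integral>\<^sup>+t. ennreal ((norm (G (y + t *\<^sub>R d)))\<^sup>2 * (norm d * exp (norm d * (1 - t)))) * indicator {1/2..1} t \<partial>lborel)"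
proof -
  define s where "s = norm d"
  define g where "g t = (norm (G (y + t *\<^sub>R d)))\<^sup>2 * (s * exp (s * (1 - t)))" for t
  have cg: "continuous_on {1/2..1} g"
    unfolding g_def by (intro continuous_intros continuous_on_compose2[OF contG]) auto
  define A where "A = integral {1/2..1} g"
  have A: "(g has_integral A) {1/2..1}"
    unfolding A_def using cg by (intro integrable_integral integrable_continuous_real)
  define \<Delta> where "\<Delta> = w (y + d) - w (y + d /\<^sub>R 2)"
  have D: "((\<lambda>t. G (y + t *\<^sub>R d) \<bullet> d) has_integral \<Delta>) {1/2..1}"
  proof -
    have "((\<lambda>t. G (y + t *\<^sub>R d) \<bullet> d) has_integral (w (y + 1 *\<^sub>R d) - w (y + (1/2) *\<^sub>R d))) {1/2..1}"
    proof (rule fundamental_theorem_of_calculus)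
      fix t :: real
      have "((\<lambda>t. w (y + t *\<^sub>R d)) has_derivative (\<lambda>h. G (y + t *\<^sub>R d) \<bullet> (h *\<^sub>R d))) (at t within {1/2..1})"
        by (rule has_derivative_compose[OF _ deriv]) (auto intro!: derivative_eq_intros)
      then show "((\<lambda>t. w (y + t *\<^sub>R d)) has_vector_derivative G (y + t *\<^sub>R d) \<bullet> d) (at t within {1/2..1})"
        by (simp add: has_vector_derivative_def)
    qed simp
    then show ?thesis by (simp add: \<Delta>_def inverse_eq_divide)
  qed
  have "\<Delta>\<^sup>2 \<le> A"
  \<comment> \<open>Cauchy-Schwarz enters through its linearised family of bounds, so that only
    monotonicity and linearity of the integral are used.\<close>
  proof (rule sq_le_if_am_gm)
    fix \<theta> :: real assume th: "\<theta> > 0"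
    let ?e = "1 - exp (- (s / 2))"
    have F: "((\<lambda>t. \<theta> / 2 * g t + 1 / (2 * \<theta>) * (s * exp (- (s * (1 - t))))) has_integral
       (\<theta> / 2 * A + 1 / (2 * \<theta>) * ?e)) {1/2..1}"
      by (intro has_integral_add has_integral_mult_right A exp_weight_has_integral)
    have le: "\<bar>G (y + t *\<^sub>R d) \<bullet> d\<bar> \<le> \<theta> / 2 * g t + 1 / (2 * \<theta>) * (s * exp (- (s * (1 - t))))" for t
    proof -
      define p where "p = norm (G (y + t *\<^sub>R d))"
      define q where "q = exp (s * (1 - t))"
      have q: "q > 0" "exp (- (s * (1 - t))) = 1 / q" by (auto simp: q_def exp_minus inverse_eq_divide)
      \<comment> \<open>AM-GM for the two factors p sqrt(s q) and sqrt(s / q), whose product is p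
        s.\<close>
      have "0 \<le> (\<theta> * p * q - 1)\<^sup>2 * s / (2 * \<theta> * q)"
        using th q by (simp add: s_def)
      also have "\<dots> = \<theta> / 2 * (p\<^sup>2 * (s * q)) + 1 / (2 * \<theta>) * (s * (1 / q)) - p * s"
        using th q by (simp add: field_simps power2_eq_square)
      finally have "p * s \<le> \<theta> / 2 * g t + 1 / (2 * \<theta>) * (s * exp (- (s * (1 - t))))"
        unfolding g_def q(2) by (simp add: p_def q_def)
      moreover have "\<bar>G (y + t *\<^sub>R d) \<bullet> d\<bar> \<le> p * s"
        unfolding p_def s_def by (rule Cauchy_Schwarz_ineq2)
      ultimately show ?thesis by linarith
    qed
    have "\<Delta> \<le> \<theta> / 2 * A + 1 / (2 * \<theta>) * ?e"
      by (rule has_integral_le[OF D F]) (use le in \<open>force simp: abs_le_iff\<close>)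
    moreover have "- \<Delta> \<le> \<theta> / 2 * A + 1 / (2 * \<theta>) * ?e"
      by (rule has_integral_le[OF has_integral_neg[OF D] F]) (use le in \<open>force simp: abs_le_iff\<close>)
    moreover have "1 / (2 * \<theta>) * ?e \<le> 1 / (2 * \<theta>) * 1"
      using th by (intro mult_left_mono) auto
    ultimately show "\<bar>\<Delta>\<bar> \<le> \<theta> / 2 * A + 1 / (2 * \<theta>)" by linarith
  qed
  moreover have "(\<integral>\<^sup>+t. ennreal (g t) * indicator {1/2..1} t \<partial>lborel) = ennreal A"
    by (rule nn_integral_has_integral_lebesgue'[OF _ A]) (simp add: g_def s_def)
  ultimately show ?thesis
    unfolding \<Delta>_def g_def s_def by (simp add: ennreal_leI)
qed

text \<open>The weight \<open>exp (norm d * (1 - t))\<close> above is chosen so that it is absorbed by the exponential gained in the substitution \<open>z = y + t d\<close>.\<close>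

lemma contraction_estimate:
  fixes y :: 'a
  shows "(\<integral>\<^sup>+d. ennreal ((w (y + d) - w (y + d /\<^sub>R 2))\<^sup>2 * exp (- 2 * norm d)) \<partial>lborel)
    \<le> ennreal (2 ^ (DIM('a) + 1)) * (\<integral>\<^sup>+d. ennreal ((norm (G (y + d)))\<^sup>2 * exp (- 2 * norm d)) \<partial>lborel)"
proof -
  let ?I = "indicator {1/2..1} :: real \<Rightarrow> ennreal"
  define F where "F t d = ennreal ((norm (G (y + t *\<^sub>R d)))\<^sup>2 * (norm d * exp (norm d * (1 - t))) * exp (- 2 * norm d)) * ?I t" for t d
  define H where "H t z = ennreal ((norm (G (y + z)))\<^sup>2 * exp (- 2 * norm z)) * (ennreal (norm z * exp (- (norm z * (1 - t)))) * ?I t)" for t z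
  have mF: "case_prod F \<in> borel_measurable (borel \<Otimes>\<^sub>M borel)" unfolding F_def by measurable
  have mH: "case_prod H \<in> borel_measurable (borel \<Otimes>\<^sub>M borel)" unfolding H_def by measurable
  have "(\<integral>\<^sup>+d. ennreal ((w (y + d) - w (y + d /\<^sub>R 2))\<^sup>2 * exp (- 2 * norm d)) \<partial>lborel)
     \<le> (\<integral>\<^sup>+d. (\<integral>\<^sup>+t. F t d \<partial>lborel) \<partial>lborel)"
  proof (rule nn_integral_mono)
    fix d :: 'a
    have "ennreal ((w (y + d) - w (y + d /\<^sub>R 2))\<^sup>2 * exp (- 2 * norm d))
      = ennreal ((w (y + d) - w (y + d /\<^sub>R 2))\<^sup>2) * ennreal (exp (- 2 * norm d))"
      by (simp add: ennreal_mult)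
    also have "\<dots> \<le> (\<integral>\<^sup>+t. ennreal ((norm (G (y + t *\<^sub>R d)))\<^sup>2 * (norm d * exp (norm d * (1 - t)))) * ?I t \<partial>lborel) * ennreal (exp (- 2 * norm d))"
      by (rule mult_right_mono[OF half_segment_sq_le]) simp
    also have "\<dots> = (\<integral>\<^sup>+t. F t d \<partial>lborel)"
      by (subst nn_integral_multc[symmetric])
         (auto intro!: nn_integral_cong simp: F_def ennreal_mult mult_ac)
    finally show "ennreal ((w (y + d) - w (y + d /\<^sub>R 2))\<^sup>2 * exp (- 2 * norm d)) \<le> (\<integral>\<^sup>+t. F t d \<partial>lborel)" .
  qed
  also have "\<dots> = (\<integral>\<^sup>+t. (\<integral>\<^sup>+d. F t d \<partial>lborel) \<partial>lborel)"
    by (rule lborel_pair_swap[OF mF])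
  also have "\<dots> \<le> (\<integral>\<^sup>+t. ennreal (2 ^ (DIM('a) + 1)) * (\<integral>\<^sup>+z. H t z \<partial>lborel) \<partial>lborel)"
  proof (rule nn_integral_mono)
    fix t :: real
    show "(\<integral>\<^sup>+d. F t d \<partial>lborel) \<le> ennreal (2 ^ (DIM('a) + 1)) * (\<integral>\<^sup>+z. H t z \<partial>lborel)"
    proof (cases "t \<in> {1/2..1}")
      case True
      then have t: "1/2 \<le> t" "t \<le> 1" by auto
      have [measurable]: "F t \<in> borel_measurable borel" unfolding F_def by measurable
      have [measurable]: "H t \<in> borel_measurable borel" unfolding H_def by measurable
      \<comment> \<open>The substitution z = t d. As t \<ge> 1/2, its Jacobian t^(-N) costs at most
        2^N; the further factor 2 comes from |d| = |z|/t \<le> 2|z|.\<close>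
      have "(\<integral>\<^sup>+d. F t d \<partial>lborel) = ennreal (\<bar>1/t\<bar> ^ DIM('a)) * (\<integral>\<^sup>+z. F t (0 + (1/t) *\<^sub>R z) \<partial>lborel)"
        by (rule nn_integral_affine) (use t in auto)
      also have "\<dots> \<le> ennreal (2 ^ DIM('a)) * (\<integral>\<^sup>+z. ennreal 2 * H t z \<partial>lborel)"
      proof (intro mult_mono nn_integral_mono ennreal_leI power_mono)
        show "\<bar>1/t\<bar> \<le> 2" using t by (simp add: field_simps)
        fix z :: 'a
        define r where "r = norm z"
        have r: "r \<ge> 0" by (simp add: r_def)
        \<comment> \<open>This is (1 - t)^2 \<ge> 0. With |d| = r/t the total exponent is -r(1 +
          t)/t, and the bound 3 - t splits it into the weight -2r and a spare -r(1 - t). The spare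
          part is what keeps the later t-integral of r exp(-r(1 - t)) below 1 for every r.\<close>
        have "1 + t * t \<ge> 2 * t" using zero_le_power2[of "t - 1"] by (simp add: power2_eq_square algebra_simps)
        then have "(1 + t) / t \<ge> 3 - t" using t by (simp add: field_simps)
        then have e: "r / t * (1 - t) + - 2 * (r / t) \<le> - 2 * r + - (r * (1 - t))"
        proof -
          have "r / t * (1 - t) + - 2 * (r / t) = - (r * ((1 + t) / t))"
            using t by (simp add: field_simps)
          also have "\<dots> \<le> - (r * (3 - t))"
            using mult_left_mono[OF \<open>(1 + t) / t \<ge> 3 - t\<close> r] by simp
          finally show ?thesis by (simp add: algebra_simps)
        qed
        have "r / t * exp (r / t * (1 - t)) * exp (- 2 * (r / t)) \<le> 2 * r * exp (- 2 * r) * exp (- (r * (1 - t)))"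
          unfolding mult.assoc exp_add[symmetric]
        proof -
          have "r / t \<le> 2 * r" using t r mult_right_mono[OF \<open>\<bar>1/t\<bar> \<le> 2\<close> r] by simp
          then show "r / t * exp (r / t * (1 - t) + - 2 * (r / t)) \<le> 2 * (r * exp (- 2 * r + - (r * (1 - t))))"
            using mult_mono[of "r / t" "2 * r" "exp (r / t * (1 - t) + - 2 * (r / t))" "exp (- 2 * r + - (r * (1 - t)))"] e t r by simp
        qed
        then have "(norm (G (y + z)))\<^sup>2 * (r / t * exp (r / t * (1 - t)) * exp (- 2 * (r / t)))
          \<le> (norm (G (y + z)))\<^sup>2 * (2 * r * exp (- 2 * r) * exp (- (r * (1 - t))))"
          by (rule mult_left_mono) simp
        moreover have "F t (0 + (1/t) *\<^sub>R z)
          = ennreal ((norm (G (y + z)))\<^sup>2 * (r / t * exp (r / t * (1 - t)) * exp (- 2 * (r / t))))"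
          using t by (simp add: F_def r_def mult_ac)
        moreover have "ennreal 2 * H t z
          = ennreal ((norm (G (y + z)))\<^sup>2 * (2 * r * exp (- 2 * r) * exp (- (r * (1 - t)))))"
          using t by (simp add: H_def r_def ennreal_mult[symmetric] mult_ac del: ennreal_numeral)
        ultimately show "F t (0 + (1/t) *\<^sub>R z) \<le> ennreal 2 * H t z"
          by (simp add: ennreal_leI del: ennreal_numeral)
      qed auto
      also have "\<dots> = ennreal (2 ^ (DIM('a) + 1)) * (\<integral>\<^sup>+z. H t z \<partial>lborel)"
      proof -
        have "(\<integral>\<^sup>+z. ennreal 2 * H t z \<partial>lborel) = ennreal 2 * (\<integral>\<^sup>+z. H t z \<partial>lborel)"
          by (rule nn_integral_cmult) simp
        then show ?thesis by (simp add: ennreal_mult mult_ac del: ennreal_numeral)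
      qed
      finally show ?thesis .
    next
      case False
      then show ?thesis by (simp add: F_def)
    qed
  qed
  also have "\<dots> = ennreal (2 ^ (DIM('a) + 1)) * (\<integral>\<^sup>+t. (\<integral>\<^sup>+z. H t z \<partial>lborel) \<partial>lborel)"
  proof (rule nn_integral_cmult)
    show "(\<lambda>t. \<integral>\<^sup>+z. H t z \<partial>lborel) \<in> borel_measurable lborel"
      using mH by (simp add: lborel.borel_measurable_nn_integral)
  qed
  also have "(\<integral>\<^sup>+t. (\<integral>\<^sup>+z. H t z \<partial>lborel) \<partial>lborel) = (\<integral>\<^sup>+z. (\<integral>\<^sup>+t. H t z \<partial>lborel) \<partial>lborel)"
    by (rule lborel_pair_swap[OF mH, symmetric])
  also have "\<dots> \<le> (\<integral>\<^sup>+z. ennreal ((norm (G (y + z)))\<^sup>2 * exp (- 2 * norm z)) \<partial>lborel)"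
  proof (rule nn_integral_mono)
    fix z :: 'a
    have "(\<integral>\<^sup>+t. H t z \<partial>lborel) = ennreal ((norm (G (y + z)))\<^sup>2 * exp (- 2 * norm z)) *
       (\<integral>\<^sup>+t. ennreal (norm z * exp (- (norm z * (1 - t)))) * ?I t \<partial>lborel)"
      unfolding H_def by (rule nn_integral_cmult) measurable
    also have "\<dots> \<le> ennreal ((norm (G (y + z)))\<^sup>2 * exp (- 2 * norm z)) * 1"
      by (rule mult_left_mono[OF nn_integral_exp_weight_le_1]) auto
    finally show "(\<integral>\<^sup>+t. H t z \<partial>lborel) \<le> ennreal ((norm (G (y + z)))\<^sup>2 * exp (- 2 * norm z))" by simp
  qed
  finally show ?thesis by (simp add: mult_left_mono)
qed

subsection \<open>A Poincare inequality for an exponential weight\<close>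

definition wenergy :: ennreal where
  "wenergy = (\<integral>\<^sup>+x. ennreal ((norm (G x))\<^sup>2 * exp (- 2 * norm x)) \<partial>lborel)"

text \<open>The map sending x to (x + y)/2 is the contraction by 1/2 about y, so
  \<open>contraction_estimate\<close> applies with centre y. The weight is centred at 0 instead;
  recentring it at y and back costs exp(2R) each time, hence exp(4R).\<close>

lemma midpoint_estimate:
  fixes y :: 'a
  assumes y: "norm y \<le> R"
  shows "(\<integral>\<^sup>+x. ennreal ((w x - w ((x + y) /\<^sub>R 2))\<^sup>2 * exp (- 2 * norm x)) \<partial>lborel)
    \<le> ennreal (exp (4 * R) * 2 ^ (DIM('a) + 1)) * wenergy"
proof -
  have shift: "exp (- 2 * norm p) \<le> exp (2 * R) * exp (- 2 * norm q)" if "norm (p - q) \<le> R" for p q :: 'a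
    using that norm_triangle_ineq2[of q p] by (simp add: exp_add[symmetric] norm_minus_commute)
  have "(\<integral>\<^sup>+x. ennreal ((w x - w ((x + y) /\<^sub>R 2))\<^sup>2 * exp (- 2 * norm x)) \<partial>lborel)
    = (\<integral>\<^sup>+d. ennreal ((w (y + d) - w ((y + d + y) /\<^sub>R 2))\<^sup>2 * exp (- 2 * norm (y + d))) \<partial>lborel)"
    by (subst nn_integral_affine[where c = 1 and t = y]) simp_all
  also have "\<dots> \<le> (\<integral>\<^sup>+d. ennreal (exp (2 * R)) * ennreal ((w (y + d) - w (y + d /\<^sub>R 2))\<^sup>2 * exp (- 2 * norm d)) \<partial>lborel)"
  proof (rule nn_integral_mono)
    fix d :: 'a
    have eq: "(y + d + y) /\<^sub>R 2 = y + d /\<^sub>R 2"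
      by (simp add: scaleR_add_right algebra_simps flip: scaleR_left.add)
    have "(w (y + d) - w (y + d /\<^sub>R 2))\<^sup>2 * exp (- 2 * norm (y + d))
      \<le> (w (y + d) - w (y + d /\<^sub>R 2))\<^sup>2 * (exp (2 * R) * exp (- 2 * norm d))"
      by (intro mult_left_mono shift) (use y in auto)
    then show "ennreal ((w (y + d) - w ((y + d + y) /\<^sub>R 2))\<^sup>2 * exp (- 2 * norm (y + d)))
      \<le> ennreal (exp (2 * R)) * ennreal ((w (y + d) - w (y + d /\<^sub>R 2))\<^sup>2 * exp (- 2 * norm d))"
      unfolding eq by (simp add: ennreal_mult[symmetric] mult_ac ennreal_leI)
  qed
  also have "\<dots> = ennreal (exp (2 * R)) * (\<integral>\<^sup>+d. ennreal ((w (y + d) - w (y + d /\<^sub>R 2))\<^sup>2 * exp (- 2 * norm d)) \<partial>lborel)"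
    by (rule nn_integral_cmult) measurable
  also have "\<dots> \<le> ennreal (exp (2 * R)) * (ennreal (2 ^ (DIM('a) + 1)) * (ennreal (exp (2 * R)) * wenergy))"
  proof (intro mult_left_mono order_trans[OF contraction_estimate])
    have "(\<integral>\<^sup>+d. ennreal ((norm (G (y + d)))\<^sup>2 * exp (- 2 * norm d)) \<partial>lborel)
      \<le> (\<integral>\<^sup>+d. ennreal (exp (2 * R)) * ennreal ((norm (G (y + d)))\<^sup>2 * exp (- 2 * norm (y + d))) \<partial>lborel)"
    proof (rule nn_integral_mono)
      fix d :: 'a
      have "(norm (G (y + d)))\<^sup>2 * exp (- 2 * norm d) \<le> (norm (G (y + d)))\<^sup>2 * (exp (2 * R) * exp (- 2 * norm (y + d)))"
        by (intro mult_left_mono shift) (use y in auto)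
      then show "ennreal ((norm (G (y + d)))\<^sup>2 * exp (- 2 * norm d))
        \<le> ennreal (exp (2 * R)) * ennreal ((norm (G (y + d)))\<^sup>2 * exp (- 2 * norm (y + d)))"
        by (simp add: ennreal_mult[symmetric] mult_ac ennreal_leI)
    qed
    also have "\<dots> = ennreal (exp (2 * R)) * (\<integral>\<^sup>+d. ennreal ((norm (G (y + d)))\<^sup>2 * exp (- 2 * norm (y + d))) \<partial>lborel)"
      by (rule nn_integral_cmult) measurable
    also have "(\<integral>\<^sup>+d. ennreal ((norm (G (y + d)))\<^sup>2 * exp (- 2 * norm (y + d))) \<partial>lborel) = wenergy"
      unfolding wenergy_def by (subst (2) nn_integral_affine[where c = 1 and t = y]) simp_all
    finally show "(\<integral>\<^sup>+d. ennreal ((norm (G (y + d)))\<^sup>2 * exp (- 2 * norm d)) \<partial>lborel) \<le> ennreal (exp (2 * R)) * wenergy" .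
  qed auto
  also have "\<dots> = ennreal (exp (2 * R) * 2 ^ (DIM('a) + 1) * exp (2 * R)) * wenergy"
    by (simp add: ennreal_mult mult_ac)
  also have "exp (2 * R) * 2 ^ (DIM('a) + 1) * exp (2 * R) = exp (4 * R) * 2 ^ (DIM('a) + 1)"
    by (simp add: exp_add[symmetric])
  finally show ?thesis .
qed

text \<open>The midpoint is symmetric in x and y, so w(x) and w(y) are compared with the same number
  m, and \<open>midpoint_estimate\<close> covers both errors after integrating over the ball. In 1 +
  exp(2R) the second summand pays for replacing the weight at x by the weight at y. Some y is no
  worse than the average over the ball, and c = w(y).\<close>

lemma ball_poincare:
  fixes R :: real
  assumes R: "R > 0"
  shows "\<exists>c. (\<integral>\<^sup>+x. ennreal ((w x - c)\<^sup>2 * exp (- 2 * norm x)) * indicator (cball 0 R) x \<partial>lborel)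
    \<le> ennreal (2 * (1 + exp (2 * R)) * (exp (4 * R) * 2 ^ (DIM('a) + 1))) * wenergy"
proof (cases "wenergy = \<infinity>")
  case True
  moreover have "0 < 2 * (1 + exp (2 * R)) * (exp (4 * R) * 2 ^ (DIM('a) + 1))"
    by (intro mult_pos_pos add_pos_pos) auto
  ultimately have "ennreal (2 * (1 + exp (2 * R)) * (exp (4 * R) * 2 ^ (DIM('a) + 1))) * wenergy = top"
    unfolding ennreal_mult_eq_top_iff by (simp only: ennreal_eq_0_iff not_le infinity_ennreal_def simp_thms)
  then show ?thesis by (simp only: top_greatest simp_thms)
next
  case False
  define \<kappa> where "\<kappa> = exp (4 * R) * 2 ^ (DIM('a) + 1)"
  define K where "K = 2 * (1 + exp (2 * R)) * \<kappa>"
  have \<kappa>: "\<kappa> > 0" and K: "K > 0" by (auto simp: \<kappa>_def K_def add_pos_pos)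
  define B :: "'a set" where "B = cball 0 R"
  have [measurable]: "B \<in> sets borel" by (simp add: B_def)
  define Q where "Q x y = ennreal ((w x - w ((x + y) /\<^sub>R 2))\<^sup>2 * exp (- 2 * norm x)) * indicator B y" for x y
  define F where "F y = (\<integral>\<^sup>+x. ennreal ((w x - w y)\<^sup>2 * exp (- 2 * norm x)) * indicator B x \<partial>lborel)" for y
  have mQ [measurable]: "case_prod Q \<in> borel_measurable (borel \<Otimes>\<^sub>M borel)" unfolding Q_def by measurable
  have mQ1 [measurable]: "(\<lambda>x. Q x y) \<in> borel_measurable borel" for y unfolding Q_def by measurable
  have mQ2 [measurable]: "(\<lambda>x. Q y x) \<in> borel_measurable borel" for y unfolding Q_def by measurable
  have mF [measurable]: "F \<in> borel_measurable borel"
    unfolding F_def by (rule lborel.borel_measurable_nn_integral) measurable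
  have mQ3 [measurable]: "(\<lambda>y. \<integral>\<^sup>+x. Q x y \<partial>lborel) \<in> borel_measurable borel"
    by (rule lborel.borel_measurable_nn_integral) (unfold Q_def, measurable)
  have mQ4 [measurable]: "(\<lambda>y. \<integral>\<^sup>+x. Q y x \<partial>lborel) \<in> borel_measurable borel"
    by (rule lborel.borel_measurable_nn_integral) (unfold Q_def, measurable)
  have Qint: "(\<integral>\<^sup>+y. (\<integral>\<^sup>+x. Q x y \<partial>lborel) \<partial>lborel) \<le> ennreal \<kappa> * wenergy * emeasure lborel B"
  proof -
    have "(\<integral>\<^sup>+y. (\<integral>\<^sup>+x. Q x y \<partial>lborel) \<partial>lborel) \<le> (\<integral>\<^sup>+y. ennreal \<kappa> * wenergy * indicator B y \<partial>lborel)"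
    proof (rule nn_integral_mono)
      fix y :: 'a
      show "(\<integral>\<^sup>+x. Q x y \<partial>lborel) \<le> ennreal \<kappa> * wenergy * indicator B y"
        using midpoint_estimate[of y R] by (cases "y \<in> B") (auto simp: Q_def B_def \<kappa>_def)
    qed
    then show ?thesis by (simp add: nn_integral_cmult_indicator)
  qed
  have "(\<integral>\<^sup>+y. F y * indicator B y \<partial>lborel) \<le> (\<integral>\<^sup>+y. (\<integral>\<^sup>+x. ennreal 2 * Q x y + ennreal (2 * exp (2 * R)) * Q y x \<partial>lborel) \<partial>lborel)"
  proof (rule nn_integral_mono)
    fix y :: 'a
    have "F y * indicator B y = (\<integral>\<^sup>+x. ennreal ((w x - w y)\<^sup>2 * exp (- 2 * norm x)) * indicator B x * indicator B y \<partial>lborel)"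
      unfolding F_def by (rule nn_integral_multc[symmetric]) measurable
    also have "\<dots> \<le> (\<integral>\<^sup>+x. ennreal 2 * Q x y + ennreal (2 * exp (2 * R)) * Q y x \<partial>lborel)"
    proof (rule nn_integral_mono)
      fix x :: 'a
      show "ennreal ((w x - w y)\<^sup>2 * exp (- 2 * norm x)) * indicator B x * indicator B y
        \<le> ennreal 2 * Q x y + ennreal (2 * exp (2 * R)) * Q y x"
      proof (cases "x \<in> B \<and> y \<in> B")
        case True
        define m where "m = w ((x + y) /\<^sub>R 2)"
        have "(w x - w y)\<^sup>2 \<le> 2 * (w x - m)\<^sup>2 + 2 * (w y - m)\<^sup>2"
          using zero_le_power2[of "w x + w y - 2 * m"] by (simp add: power2_eq_square algebra_simps)
        then have "(w x - w y)\<^sup>2 * exp (- 2 * norm x) \<le> (2 * (w x - m)\<^sup>2 + 2 * (w y - m)\<^sup>2) * exp (- 2 * norm x)"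
          by (rule mult_right_mono) simp
        also have "\<dots> \<le> 2 * ((w x - m)\<^sup>2 * exp (- 2 * norm x)) + 2 * exp (2 * R) * ((w y - m)\<^sup>2 * exp (- 2 * norm y))"
        proof -
          have "exp (- 2 * norm x) \<le> exp (2 * R) * exp (- 2 * norm y)"
            using True norm_ge_zero[of x] unfolding exp_add[symmetric] exp_le_cancel_iff B_def mem_cball_0 by linarith
          then have "2 * (w y - m)\<^sup>2 * exp (- 2 * norm x) \<le> 2 * (w y - m)\<^sup>2 * (exp (2 * R) * exp (- 2 * norm y))"
            by (intro mult_left_mono) auto
          then show ?thesis by (simp add: algebra_simps)
        qed
        finally show ?thesis
          using True by (simp add: Q_def m_def add.commute ennreal_mult[symmetric] ennreal_plus[symmetric] ennreal_leI
            del: ennreal_plus ennreal_numeral)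
      qed auto
    qed
    finally show "F y * indicator B y \<le> (\<integral>\<^sup>+x. ennreal 2 * Q x y + ennreal (2 * exp (2 * R)) * Q y x \<partial>lborel)" .
  qed
  also have "\<dots> = ennreal 2 * (\<integral>\<^sup>+y. (\<integral>\<^sup>+x. Q x y \<partial>lborel) \<partial>lborel)
      + ennreal (2 * exp (2 * R)) * (\<integral>\<^sup>+y. (\<integral>\<^sup>+x. Q y x \<partial>lborel) \<partial>lborel)"
    by (simp add: nn_integral_add nn_integral_cmult del: ennreal_numeral ennreal_mult)
  also have "(\<integral>\<^sup>+y. (\<integral>\<^sup>+x. Q y x \<partial>lborel) \<partial>lborel) = (\<integral>\<^sup>+y. (\<integral>\<^sup>+x. Q x y \<partial>lborel) \<partial>lborel)"
    by (rule lborel_pair_swap[OF mQ, symmetric])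
  also have "ennreal 2 * (\<integral>\<^sup>+y. (\<integral>\<^sup>+x. Q x y \<partial>lborel) \<partial>lborel) + ennreal (2 * exp (2 * R)) * (\<integral>\<^sup>+y. (\<integral>\<^sup>+x. Q x y \<partial>lborel) \<partial>lborel)
     = ennreal (2 * (1 + exp (2 * R))) * (\<integral>\<^sup>+y. (\<integral>\<^sup>+x. Q x y \<partial>lborel) \<partial>lborel)"
    by (subst distrib_right[symmetric], subst ennreal_plus[symmetric]) (auto simp: algebra_simps)
  also have "\<dots> \<le> ennreal (2 * (1 + exp (2 * R))) * (ennreal \<kappa> * wenergy * emeasure lborel B)"
    by (rule mult_left_mono[OF Qint]) simp
  also have "\<dots> = ennreal K * wenergy * emeasure lborel B"
    using \<kappa> by (simp add: K_def ennreal_mult mult_ac)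
  finally have le: "(\<integral>\<^sup>+y. F y * indicator B y \<partial>lborel) \<le> ennreal K * wenergy * emeasure lborel B" .
  \<comment> \<open>Pigeonhole on the ball, which has positive and finite measure. Finiteness of
    \<open>wenergy\<close> is needed to make the comparison of integrals strict.\<close>
  have "\<exists>y\<in>B. F y \<le> ennreal K * wenergy"
  proof (rule ccontr)
    assume "\<not> ?thesis"
    then have gt: "F y > ennreal K * wenergy" if "y \<in> B" for y using that by auto
    have Bfin: "emeasure lborel B < \<infinity>" unfolding B_def by (rule emeasure_lborel_cball_finite)
    have "(\<integral>\<^sup>+y. ennreal K * wenergy * indicator B y \<partial>lborel) < (\<integral>\<^sup>+y. F y * indicator B y \<partial>lborel)"
    proof (rule nn_integral_less)
      show "(\<integral>\<^sup>+y. ennreal K * wenergy * indicator B y \<partial>lborel) \<noteq> \<infinity>"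
        using Bfin False by (simp add: nn_integral_cmult_indicator ennreal_mult_eq_top_iff)
      show "AE y in lborel. ennreal K * wenergy * indicator B y \<le> F y * indicator B y"
        using gt by (intro AE_I2) (auto simp: indicator_def less_imp_le)
      show "\<not> (AE y in lborel. F y * indicator B y \<le> ennreal K * wenergy * indicator B y)"
      proof
        assume "AE y in lborel. F y * indicator B y \<le> ennreal K * wenergy * indicator B y"
        then have "AE y in lborel. y \<notin> B"
          by (rule AE_mp) (use gt in \<open>auto intro!: AE_I2 simp: not_le[symmetric]\<close>)
        \<comment> \<open>Passing to the open ball makes the complement closed, and a closed set
          containing almost every point is the whole space.\<close>
        then have "AE y in lborel. y \<in> - ball (0::'a) R"
          by (rule AE_mp) (auto intro!: AE_I2 simp: B_def)
        then have "AE y in lebesgue. y \<in> - ball (0::'a) R"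
          by (rule AE_completion)
        then have "(0::'a) \<in> - ball 0 R"
          by (intro mem_closed_if_AE_lebesgue) auto
        then show False using R by simp
      qed
    qed measurable
    then show False using le by (simp add: nn_integral_cmult_indicator)
  qed
  then obtain y where "F y \<le> ennreal K * wenergy" by blast
  then show ?thesis unfolding F_def B_def K_def \<kappa>_def by blast
qed

text \<open>Write w(x) - c as (w(x) - w(x/2)) + (w(x/2) - c). The first part is
  \<open>contraction_estimate\<close> at y = 0. In the second, x = 2z leaves an extra factor
  exp(-2|z|): at most 1 inside radius R, where the hypothesis on the ball applies, and at most
  exp(-2R) outside. The outer part returns as at most half of the left side and is absorbed, which
  doubles the remaining constant p(2 + k), with p = 2^(N+1).\<close>

lemma truncated_poincare:
  fixes R c k :: real
  assumes R: "R > 0" and R2: "2 ^ (DIM('a) + 1) * exp (- 2 * R) \<le> 1 / 2" and k: "k > 0"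
    and ball: "(\<integral>\<^sup>+x. ennreal ((w x - c)\<^sup>2 * exp (- 2 * norm x)) * indicator (cball 0 R) x \<partial>lborel)
      \<le> ennreal k * wenergy"
  shows "(\<integral>\<^sup>+x. ennreal ((w x - c)\<^sup>2 * exp (- 2 * norm x)) * indicator (cball 0 \<rho>) x \<partial>lborel)
    \<le> ennreal (2 * 2 ^ (DIM('a) + 1) * (2 + k)) * wenergy"
proof (cases "wenergy = \<infinity>")
  case True
  have "0 < 2 * 2 ^ (DIM('a) + 1) * (2 + k)" using k by simp
  then have "ennreal (2 * 2 ^ (DIM('a) + 1) * (2 + k)) * wenergy = top"
    using True unfolding ennreal_mult_eq_top_iff by (simp only: ennreal_eq_0_iff not_le infinity_ennreal_def simp_thms)
  then show ?thesis by (simp only: top_greatest)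
next
  case False
  define p :: real where "p = 2 ^ (DIM('a) + 1)"
  have p: "p > 0" by (simp add: p_def)
  have [measurable]: "cball (0::'a) r \<in> sets borel" for r by simp
  define g where "g x = (w x - c)\<^sup>2 * exp (- 2 * norm x)" for x
  have g0: "g x \<ge> 0" for x by (simp add: g_def)
  have [measurable]: "g \<in> borel_measurable borel" unfolding g_def by measurable
  define M where "M r = (\<integral>\<^sup>+x. ennreal (g x) * indicator (cball 0 r) x \<partial>lborel)" for r :: real
  \<comment> \<open>Without finiteness the final subtraction of half of the left side would be
    meaningless; this is the reason for the truncation.\<close>
  have fin: "M \<rho> < \<infinity>"
  proof -
    have "integrable lborel (\<lambda>x. indicator (cball 0 \<rho>) x *\<^sub>R g x)"
      unfolding g_def by (intro borel_integrable_compact continuous_intros continuous_on_subset[OF cont]) auto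
    then have "(\<integral>\<^sup>+x. ennreal (indicator (cball 0 \<rho>) x *\<^sub>R g x) \<partial>lborel) < \<infinity>"
      by (subst nn_integral_eq_integral) (auto simp: g0)
    also have "(\<integral>\<^sup>+x. ennreal (indicator (cball 0 \<rho>) x *\<^sub>R g x) \<partial>lborel) = M \<rho>"
      unfolding M_def by (intro nn_integral_cong) (simp add: indicator_def)
    finally show ?thesis .
  qed
  define A where "A = (\<integral>\<^sup>+x. ennreal ((w x - w (x /\<^sub>R 2))\<^sup>2 * exp (- 2 * norm x)) \<partial>lborel)"
  have A: "A \<le> ennreal p * wenergy"
    using contraction_estimate[of 0] by (simp add: A_def wenergy_def p_def)
  define S where "S = (\<integral>\<^sup>+x. ennreal ((w (x /\<^sub>R 2) - c)\<^sup>2 * exp (- 2 * norm x)) * indicator (cball 0 \<rho>) x \<partial>lborel)"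
  have S: "S \<le> ennreal (p / 2) * (M R + ennreal (exp (- 2 * R)) * M \<rho>)"
  proof -
    have "S = ennreal (\<bar>2\<bar> ^ DIM('a)) * (\<integral>\<^sup>+x. ennreal ((w ((0 + 2 *\<^sub>R x) /\<^sub>R 2) - c)\<^sup>2 * exp (- 2 * norm (0 + 2 *\<^sub>R x)))
        * indicator (cball 0 \<rho>) (0 + 2 *\<^sub>R x) \<partial>lborel)"
      unfolding S_def
    proof (rule nn_integral_affine)
      show "(\<lambda>x. ennreal ((w (x /\<^sub>R 2) - c)\<^sup>2 * exp (- 2 * norm x)) * indicator (cball 0 \<rho>) x) \<in> borel_measurable borel"
        by measurable
    qed simp
    also have "\<dots> \<le> ennreal (p / 2) * (\<integral>\<^sup>+x. ennreal (g x) * indicator (cball 0 R) x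
        + ennreal (exp (- 2 * R)) * (ennreal (g x) * indicator (cball 0 \<rho>) x) \<partial>lborel)"
    proof (intro mult_mono nn_integral_mono)
      show "ennreal (\<bar>2\<bar> ^ DIM('a)) \<le> ennreal (p / 2)" by (simp add: p_def)
      fix x :: 'a
      show "ennreal ((w ((0 + 2 *\<^sub>R x) /\<^sub>R 2) - c)\<^sup>2 * exp (- 2 * norm (0 + 2 *\<^sub>R x))) * indicator (cball 0 \<rho>) (0 + 2 *\<^sub>R x)
        \<le> ennreal (g x) * indicator (cball 0 R) x + ennreal (exp (- 2 * R)) * (ennreal (g x) * indicator (cball 0 \<rho>) x)"
      proof (cases "2 * norm x \<le> \<rho>")
        case True
        \<comment> \<open>A centred ball is stable under halving, so the truncated integral is
          bounded in terms of itself and not of a larger ball.\<close>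
        then have xr: "x \<in> cball 0 \<rho>" using norm_ge_zero[of x] unfolding mem_cball_0 by linarith
        have e: "exp (- 4 * norm x) = exp (- 2 * norm x) * exp (- 2 * norm x)" by (simp add: exp_add[symmetric])
        have lhs: "ennreal ((w ((0 + 2 *\<^sub>R x) /\<^sub>R 2) - c)\<^sup>2 * exp (- 2 * norm (0 + 2 *\<^sub>R x))) * indicator (cball 0 \<rho>) (0 + 2 *\<^sub>R x)
          = ennreal (exp (- 2 * norm x) * g x)"
          using True e by (simp add: g_def mult_ac)
        show ?thesis
        proof (cases "norm x \<le> R")
          case True
          have "exp (- 2 * norm x) * g x \<le> 1 * g x" by (intro mult_right_mono g0) simp
          then have "ennreal (exp (- 2 * norm x) * g x) \<le> ennreal (g x) * indicator (cball 0 R) x"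
            using True by (simp add: ennreal_leI)
          then show ?thesis unfolding lhs by (rule order_trans) simp
        next
          case False
          have "exp (- 2 * norm x) * g x \<le> exp (- 2 * R) * g x" using False by (intro mult_right_mono g0) simp
          then have "ennreal (exp (- 2 * norm x) * g x) \<le> ennreal (exp (- 2 * R)) * (ennreal (g x) * indicator (cball 0 \<rho>) x)"
            using xr g0 by (simp add: ennreal_leI ennreal_mult[symmetric])
          then show ?thesis unfolding lhs by (rule order_trans) simp
        qed
      qed auto
    qed auto
    also have "\<dots> = ennreal (p / 2) * (M R + ennreal (exp (- 2 * R)) * M \<rho>)"
      unfolding M_def by (subst nn_integral_add) (auto simp: nn_integral_cmult)
    finally show ?thesis .
  qed
  have "M \<rho> \<le> (\<integral>\<^sup>+x. ennreal 2 * ennreal ((w x - w (x /\<^sub>R 2))\<^sup>2 * exp (- 2 * norm x))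
      + ennreal 2 * (ennreal ((w (x /\<^sub>R 2) - c)\<^sup>2 * exp (- 2 * norm x)) * indicator (cball 0 \<rho>) x) \<partial>lborel)"
    unfolding M_def
  proof (rule nn_integral_mono)
    fix x :: 'a
    define m where "m = w (x /\<^sub>R 2)"
    have "(w x - c)\<^sup>2 \<le> 2 * (w x - m)\<^sup>2 + 2 * (m - c)\<^sup>2"
      using zero_le_power2[of "w x + c - 2 * m"] by (simp add: power2_eq_square algebra_simps)
    then have "g x \<le> (2 * (w x - m)\<^sup>2 + 2 * (m - c)\<^sup>2) * exp (- 2 * norm x)"
      unfolding g_def by (rule mult_right_mono) simp
    then have "ennreal (g x) \<le> ennreal 2 * ennreal ((w x - m)\<^sup>2 * exp (- 2 * norm x)) + ennreal 2 * ennreal ((m - c)\<^sup>2 * exp (- 2 * norm x))"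
      by (simp add: ennreal_mult[symmetric] ennreal_plus[symmetric] ennreal_leI algebra_simps del: ennreal_plus ennreal_numeral)
    then show "ennreal (g x) * indicator (cball 0 \<rho>) x \<le> ennreal 2 * ennreal ((w x - w (x /\<^sub>R 2))\<^sup>2 * exp (- 2 * norm x))
      + ennreal 2 * (ennreal ((w (x /\<^sub>R 2) - c)\<^sup>2 * exp (- 2 * norm x)) * indicator (cball 0 \<rho>) x)"
      unfolding m_def[symmetric] by (auto simp: indicator_def)
  qed
  also have "\<dots> = ennreal 2 * A + ennreal 2 * S"
    unfolding A_def S_def by (subst nn_integral_add) (auto simp: nn_integral_cmult simp del: ennreal_numeral)
  also have "\<dots> \<le> ennreal 2 * (ennreal p * wenergy) + ennreal 2 * (ennreal (p / 2) * (ennreal k * wenergy + ennreal (exp (- 2 * R)) * M \<rho>))"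
    by (intro add_mono mult_left_mono A order_trans[OF S] order_refl) (use ball in \<open>auto simp: M_def g_def\<close>)
  finally have main: "M \<rho> \<le> \<dots>" .
  obtain e where e: "wenergy = ennreal e" "e \<ge> 0" using False by (cases wenergy) auto
  obtain m where m: "M \<rho> = ennreal m" "m \<ge> 0" using fin by (cases "M \<rho>") auto
  have "ennreal m \<le> ennreal (2 * (p * e) + 2 * (p / 2 * (k * e + exp (- 2 * R) * m)))"
    using main e m p k by (simp add: ennreal_mult[symmetric] ennreal_plus[symmetric] del: ennreal_plus ennreal_numeral)
  then have "m \<le> 2 * (p * e) + 2 * (p / 2 * (k * e + exp (- 2 * R) * m))"
    by (rule ennreal_le_iff[THEN iffD1, rotated]) (use e m p k in auto)
  \<comment> \<open>The absorption: the term in m on the right has coefficient 2 (p/2) exp(-2R),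
    which is at most 1/2.\<close>
  moreover have "p * exp (- 2 * R) * m \<le> 1 / 2 * m" using R2 m(2) unfolding p_def by (rule mult_right_mono)
  ultimately have "m \<le> 2 * p * (2 + k) * e" by (simp add: algebra_simps)
  then have "ennreal m \<le> ennreal (2 * p * (2 + k)) * ennreal e"
    using e p k by (simp add: ennreal_mult[symmetric] ennreal_leI)
  then show ?thesis using e m by (simp add: M_def g_def p_def)
qed

end

text \<open>The bound of \<open>truncated_poincare\<close> for the radius R = n + 1, with k taken
  from \<open>ball_poincare\<close>. This radius is large enough because exp 2 \<ge> 4 gives 2^(n+1)
  exp(-2R) \<le> 2^(-(n+1)) \<le> 1/2.\<close>

definition poincare_const :: "nat \<Rightarrow> real" where
  "poincare_const n = 2 * 2 ^ (n + 1) *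
     (2 + 2 * (1 + exp (2 * (real n + 1))) * (exp (4 * (real n + 1)) * 2 ^ (n + 1)))"

lemma poincare_const_pos: "poincare_const n > 0"
  unfolding poincare_const_def by (intro mult_pos_pos add_pos_pos) auto

context C1_field
begin

text \<open>Both c and the constant are fixed before the truncation radius, so monotone convergence
  over growing balls removes the truncation.\<close>

lemma exp_poincare_unit:
  "\<exists>c. (\<integral>\<^sup>+x. ennreal ((w x - c)\<^sup>2 * exp (- 2 * norm x)) \<partial>lborel)
    \<le> ennreal (poincare_const DIM('a)) * (\<integral>\<^sup>+x. ennreal ((norm (G x))\<^sup>2 * exp (- 2 * norm x)) \<partial>lborel)"
proof -
  define R where "R = real DIM('a) + 1"
  define k where "k = 2 * (1 + exp (2 * R)) * (exp (4 * R) * 2 ^ (DIM('a) + 1))"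
  have R: "R > 0" by (simp add: R_def)
  have k: "k > 0" unfolding k_def by (intro mult_pos_pos add_pos_pos) auto
  have "2 ^ (DIM('a) + 1) * exp (- 2 * R) \<le> 1 / 2"
  proof -
    have "4 \<le> exp (2::real)"
      using power_mono[of 2 "exp 1 :: real" 2] exp_ge_add_one_self[of "1::real"] by (simp add: exp_of_nat_mult[symmetric])
    then have "4 ^ (DIM('a) + 1) \<le> exp (2::real) ^ (DIM('a) + 1)" by (rule power_mono) simp
    also have "\<dots> = exp (2 * R)" by (simp add: exp_of_nat_mult[symmetric] R_def exp_add algebra_simps)
    finally have "(2 * 2) ^ (DIM('a) + 1) \<le> exp (2 * R)" by simp
    then have "2 ^ (DIM('a) + 1) * 2 ^ (DIM('a) + 1) \<le> exp (2 * R)" by (simp only: power_mult_distrib)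
    moreover have "2 * 2 ^ (DIM('a) + 1) \<le> (2 ^ (DIM('a) + 1) * 2 ^ (DIM('a) + 1) :: real)"
      by (intro mult_right_mono) auto
    ultimately have "2 * 2 ^ (DIM('a) + 1) \<le> exp (2 * R)" by linarith
    then show ?thesis by (simp add: exp_minus field_simps)
  qed
  moreover obtain c where "(\<integral>\<^sup>+x. ennreal ((w x - c)\<^sup>2 * exp (- 2 * norm x)) * indicator (cball 0 R) x \<partial>lborel)
    \<le> ennreal k * wenergy"
    using ball_poincare[OF R] unfolding k_def by blast
  ultimately have tr: "(\<integral>\<^sup>+x. ennreal ((w x - c)\<^sup>2 * exp (- 2 * norm x)) * indicator (cball 0 (real n)) x \<partial>lborel)
    \<le> ennreal (poincare_const DIM('a)) * wenergy" for n
    using truncated_poincare[OF R _ k, of c "real n"] by (simp add: poincare_const_def R_def k_def)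
  define g where "g n x = ennreal ((w x - c)\<^sup>2 * exp (- 2 * norm x)) * indicator (cball 0 (real n)) x" for n x
  have "(\<integral>\<^sup>+x. ennreal ((w x - c)\<^sup>2 * exp (- 2 * norm x)) \<partial>lborel) \<le> (\<integral>\<^sup>+x. (SUP n. g n x) \<partial>lborel)"
  proof (rule nn_integral_mono)
    fix x :: 'a
    obtain n where "norm x \<le> real n" using real_arch_simple by blast
    then show "ennreal ((w x - c)\<^sup>2 * exp (- 2 * norm x)) \<le> (SUP n. g n x)"
      by (intro SUP_upper2[of n]) (auto simp: g_def)
  qed
  also have "\<dots> = (SUP n. integral\<^sup>N lborel (g n))"
    by (rule nn_integral_monotone_convergence_SUP)
       (auto simp: incseq_def le_fun_def g_def indicator_def)
  also have "\<dots> \<le> ennreal (poincare_const DIM('a)) * wenergy"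
    using tr unfolding g_def[abs_def] by (intro SUP_least)
  finally show ?thesis unfolding wenergy_def by blast
qed

end

text \<open>Dilation by b reduces to b = 1: the Jacobian b^N appears on both sides and cancels,
  being positive and finite, while the squared gradient contributes 1/b^2.\<close>

lemma exp_poincare:
  fixes w :: "'a::euclidean_space \<Rightarrow> real" and G :: "'a \<Rightarrow> 'a"
  assumes "C1_field w G" and b: "b > 0"
  shows "\<exists>c. (\<integral>\<^sup>+x. ennreal ((w x - c)\<^sup>2 * exp (- 2 * b * norm x)) \<partial>lborel)
    \<le> ennreal (poincare_const DIM('a) / b\<^sup>2) * (\<integral>\<^sup>+x. ennreal ((norm (G x))\<^sup>2 * exp (- 2 * b * norm x)) \<partial>lborel)"
proof -
  interpret C1_field w G by fact
  define w' where "w' x = w (x /\<^sub>R b)" for x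
  define G' where "G' x = G (x /\<^sub>R b) /\<^sub>R b" for x
  have "C1_field w' G'"
  proof
    fix x
    have "((\<lambda>x. w (x /\<^sub>R b)) has_derivative (\<lambda>h. G (x /\<^sub>R b) \<bullet> (h /\<^sub>R b))) (at x)"
      by (rule has_derivative_compose[OF _ deriv]) (auto intro!: derivative_eq_intros)
    then show "(w' has_derivative (\<lambda>h. G' x \<bullet> h)) (at x)"
      by (simp add: w'_def[abs_def] G'_def)
    show "continuous_on UNIV G'"
      unfolding G'_def by (intro continuous_intros continuous_on_compose2[OF contG]) auto
  qed
  then interpret W: C1_field w' G' .
  obtain c where c: "(\<integral>\<^sup>+x. ennreal ((w' x - c)\<^sup>2 * exp (- 2 * norm x)) \<partial>lborel)
    \<le> ennreal (poincare_const DIM('a)) * (\<integral>\<^sup>+x. ennreal ((norm (G' x))\<^sup>2 * exp (- 2 * norm x)) \<partial>lborel)"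
    using W.exp_poincare_unit by blast
  let ?L = "\<integral>\<^sup>+x. ennreal ((w x - c)\<^sup>2 * exp (- 2 * b * norm x)) \<partial>lborel"
  let ?E = "\<integral>\<^sup>+x. ennreal ((norm (G x))\<^sup>2 * exp (- 2 * b * norm x)) \<partial>lborel"
  let ?j = "ennreal (b ^ DIM('a))"
  have "(\<integral>\<^sup>+x. ennreal ((w' x - c)\<^sup>2 * exp (- 2 * norm x)) \<partial>lborel) = ?j * ?L"
    using b by (subst nn_integral_affine[where c = b and t = 0]) (auto simp: w'_def mult.assoc)
  moreover have "(\<integral>\<^sup>+x. ennreal ((norm (G' x))\<^sup>2 * exp (- 2 * norm x)) \<partial>lborel) = ?j * (ennreal (1 / b\<^sup>2) * ?E)"
  proof -
    have "(\<integral>\<^sup>+x. ennreal ((norm (G' x))\<^sup>2 * exp (- 2 * norm x)) \<partial>lborel)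
      = ?j * (\<integral>\<^sup>+x. ennreal ((norm (G' (0 + b *\<^sub>R x)))\<^sup>2 * exp (- 2 * norm (0 + b *\<^sub>R x))) \<partial>lborel)"
      using b by (subst nn_integral_affine[where c = b and t = 0]) auto
    also have "(\<integral>\<^sup>+x. ennreal ((norm (G' (0 + b *\<^sub>R x)))\<^sup>2 * exp (- 2 * norm (0 + b *\<^sub>R x))) \<partial>lborel)
      = (\<integral>\<^sup>+x. ennreal (1 / b\<^sup>2) * ennreal ((norm (G x))\<^sup>2 * exp (- 2 * b * norm x)) \<partial>lborel)"
      using b by (intro nn_integral_cong)
        (simp add: G'_def ennreal_mult[symmetric] power_mult_distrib power_divide mult_ac divide_simps)
    also have "\<dots> = ennreal (1 / b\<^sup>2) * ?E" by (rule nn_integral_cmult) measurable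
    finally show ?thesis .
  qed
  ultimately have "?j * ?L \<le> ennreal (poincare_const DIM('a)) * (?j * (ennreal (1 / b\<^sup>2) * ?E))"
    using c by simp
  also have "\<dots> = ?j * (ennreal (poincare_const DIM('a) * (1 / b\<^sup>2)) * ?E)"
    by (subst ennreal_mult) (auto simp: mult_ac poincare_const_pos less_imp_le)
  finally have "?j * ?L \<le> ?j * (ennreal (poincare_const DIM('a) * (1 / b\<^sup>2)) * ?E)" .
  then have "?L \<le> ennreal (poincare_const DIM('a) * (1 / b\<^sup>2)) * ?E"
    by (subst (asm) ennreal_mult_le_mult_iff) (use b in auto)
  then show ?thesis by auto
qed

subsection \<open>The energy identity\<close>

lemma integral_affine_lborel:
  fixes f :: "'a::euclidean_space \<Rightarrow> real"
  assumes [measurable]: "f \<in> borel_measurable borel" and c: "c \<noteq> 0"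
  shows "(LINT x|lborel. f x) = \<bar>c\<bar> ^ DIM('a) * (LINT x|lborel. f (t + c *\<^sub>R x))"
  by (subst lborel_affine[OF c, of t]) (simp add: integral_density integral_distr)

text \<open>Integrands divided by |x| are continuous only off the origin; vanishing near 0 confines
  them to a compact annulus that avoids it.\<close>

lemma integrable_annulus_support:
  fixes f :: "'a::euclidean_space \<Rightarrow> real"
  assumes "continuous_on (- {0}) f" and r: "r > 0"
    and "\<And>x. norm x < r \<Longrightarrow> f x = 0" "\<And>x. norm x > R \<Longrightarrow> f x = 0"
  shows "integrable lborel f"
proof -
  define K where "K = cball 0 R - ball (0::'a) r"
  have "integrable lborel (\<lambda>x. indicator K x *\<^sub>R f x)"
    using r by (intro borel_integrable_compact continuous_on_subset[OF assms(1)])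
      (auto simp: K_def intro!: compact_diff)
  also have "(\<lambda>x. indicator K x *\<^sub>R f x) = f"
  proof
    fix x
    show "indicator K x *\<^sub>R f x = f x"
    proof (cases "x \<in> K")
      case False
      then consider "norm x < r" | "norm x > R" by (auto simp: K_def)
      then show ?thesis by cases (auto simp: assms(3,4))
    qed simp
  qed
  finally show ?thesis .
qed

text \<open>Vanishing on a ball about 0 does two jobs: it neutralises the singularity of 1/|x|, and
  it makes products with exp(b|x|) differentiable at the origin, where the norm is not.\<close>

locale C1_annulus = C1_field w G for w :: "'a::euclidean_space \<Rightarrow> real" and G +
  fixes r R :: real
  assumes r: "r > 0"
    and near: "\<And>x. norm x < r \<Longrightarrow> w x = 0"
    and far: "\<And>x. norm x > R \<Longrightarrow> w x = 0"
begin

lemma G_near: "norm x < r \<Longrightarrow> G x = 0" and G_far: "norm x > R \<Longrightarrow> G x = 0"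
proof -
  have *: "G x = 0" if "open S" "x \<in> S" "\<And>z. z \<in> S \<Longrightarrow> w z = 0" for S x
  proof -
    have "(w has_derivative (\<lambda>_. 0)) (at x)"
      by (rule has_derivative_transform_within_open[OF has_derivative_const that(1,2)]) (simp add: that(3))
    from fun_cong[OF has_derivative_unique[OF this deriv], of "G x"]
     show ?thesis by simp
  qed
  show "norm x < r \<Longrightarrow> G x = 0" by (rule *[of "ball 0 r"]) (auto simp: near)
  show "norm x > R \<Longrightarrow> G x = 0" by (rule *[of "- cball 0 R"]) (auto simp: far)
qed

lemma integrable_annulus:
  assumes "continuous_on (- {0}) f" "\<And>x. w x = 0 \<Longrightarrow> G x = 0 \<Longrightarrow> f x = (0::real)"
  shows "integrable lborel f"
  using assms near far G_near G_far r by (intro integrable_annulus_support[of f r R]) auto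

lemmas cont_w [continuous_intros] = continuous_on_compose2[OF cont]
lemmas cont_G [continuous_intros] = continuous_on_compose2[OF contG]

text \<open>Differentiate the scaling law \<open>\<integral> w(tx)/|x| dx = t^(1-N) \<integral> w(x)/|x| dx\<close> at \<open>t = 1\<close>; this replaces
  the divergence theorem for the field \<open>x/|x|\<close>.\<close>

lemma radial_derivative_integral:
  "(LINT x|lborel. G x \<bullet> x / norm x) = (1 - real DIM('a)) * (LINT x|lborel. w x / norm x)"
proof -
  define I where "I = (LINT x|lborel. w x / norm x)"
  \<comment> \<open>Increments along a sequence, as dominated convergence requires; s \<le> 1 keeps
    (1 + s) x within radius 2R whenever |x| \<le> R.\<close>
  define s where "s n = inverse (real (Suc n))" for n
  have s: "0 < s n" "s n \<le> 1" for n by (auto simp: s_def field_simps)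
  have s0: "filterlim s (at 0) sequentially"
  proof -
    have "s \<longlonglongrightarrow> 0" unfolding s_def by (rule LIMSEQ_inverse_real_of_nat)
    then show ?thesis unfolding filterlim_at using s(1) by (auto simp: less_imp_neq[symmetric])
  qed
  define q where "q n x = (w ((1 + s n) *\<^sub>R x) - w x) / s n / norm x" for n x
  have bounded: "bounded (G ` cball 0 (2 * R))"
    by (intro compact_imp_bounded compact_continuous_image continuous_on_subset[OF contG]) auto
  then obtain M where "\<forall>z\<in>G ` cball 0 (2 * R). norm z \<le> M"
    unfolding bounded_iff by blast
  then have M: "norm (G x) \<le> M" if "norm x \<le> 2 * R" for x
    using that by auto
  have "(\<lambda>n. LINT x|lborel. q n x) \<longlonglongrightarrow> (LINT x|lborel. G x \<bullet> x / norm x)"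
  proof (rule integral_dominated_convergence)
    show "(\<lambda>x. G x \<bullet> x / norm x) \<in> borel_measurable lborel" by measurable
    show "q n \<in> borel_measurable lborel" for n unfolding q_def by measurable
    \<comment> \<open>The dominating function comes from the mean value inequality: the increment of
      w is at most M s |x|, so dividing by s |x| leaves M. Outside radius R both values of w
      vanish.\<close>
    show "integrable lborel (\<lambda>x::'a. indicator (cball 0 R) x *\<^sub>R M)"
      by (rule borel_integrable_compact) auto
    show "AE x in lborel. (\<lambda>n. q n x) \<longlonglongrightarrow> G x \<bullet> x / norm x"
    proof (rule AE_I2)
      fix x :: 'a
      have "((\<lambda>h. w ((1 + h) *\<^sub>R x)) has_derivative (\<lambda>h. G ((1 + 0) *\<^sub>R x) \<bullet> (h *\<^sub>R x))) (at 0)"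
        by (rule has_derivative_compose[OF _ deriv]) (auto intro!: derivative_eq_intros)
      then have "((\<lambda>h. w ((1 + h) *\<^sub>R x)) has_field_derivative (G x \<bullet> x)) (at 0)"
        by (simp add: has_field_derivative_def mult_commute_abs)
      then have "((\<lambda>h. (w ((1 + h) *\<^sub>R x) - w x) / h) \<longlongrightarrow> G x \<bullet> x) (at 0)"
        by (simp add: DERIV_def)
      from tendsto_mult_right[OF filterlim_compose[OF this s0], of "inverse (norm x)"]
      show "(\<lambda>n. q n x) \<longlonglongrightarrow> G x \<bullet> x / norm x"
        unfolding q_def divide_inverse .
    qed
    show "AE x in lborel. norm (q n x) \<le> indicator (cball 0 R) x *\<^sub>R M" for n
    proof (rule AE_I2)
      fix x :: 'a
      show "norm (q n x) \<le> indicator (cball 0 R) x *\<^sub>R M"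
      proof (cases "norm x \<le> R")
        case True
        have n1: "norm ((1 + s n) *\<^sub>R x) \<le> 2 * R"
          using True s[of n] mult_mono[of "1 + s n" 2 "norm x" R] by simp
        have n2: "norm x \<le> 2 * R" using True norm_ge_zero[of x] by linarith
        have "norm (w ((1 + s n) *\<^sub>R x) - w x) \<le> M * norm ((1 + s n) *\<^sub>R x - x)"
        proof (rule differentiable_bound[of "cball 0 (2 * R)" _ "\<lambda>x h. G x \<bullet> h"])
          show "onorm (\<lambda>h. G z \<bullet> h) \<le> M" if "z \<in> cball 0 (2 * R)" for z
          proof (rule onorm_bound)
            show "0 \<le> M" using order_trans[OF norm_ge_zero M[of z]] that by simp
            show "norm (G z \<bullet> h) \<le> M * norm h" for h
              using Cauchy_Schwarz_ineq2[of "G z" h] mult_right_mono[OF M[of z], of "norm h"] that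
              by simp
          qed
        qed (use n1 n2 in \<open>auto intro: has_derivative_at_withinI deriv\<close>)
        also have "\<dots> = M * s n * norm x" using s[of n] by (simp add: scaleR_add_left)
        finally have "\<bar>w ((1 + s n) *\<^sub>R x) - w x\<bar> \<le> M * s n * norm x" by simp
        moreover have "M \<ge> 0" using order_trans[OF norm_ge_zero M[of x]] True norm_ge_zero[of x] by linarith
        ultimately show ?thesis
          using True s[of n] by (cases "x = 0") (auto simp: q_def abs_mult field_simps)
      next
        case False
        then have "norm ((1 + s n) *\<^sub>R x) > R"
          using s[of n] mult_right_mono[of 1 "1 + s n" "norm x"] by simp
        then show ?thesis using False by (simp add: q_def far)
      qed
    qed
  qed
  moreover have "(LINT x|lborel. q n x) = ((1 + s n) / (1 + s n) ^ DIM('a) - 1) / s n * I" for n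
  proof -
    \<comment> \<open>Since c > 1, the dilated function still vanishes beyond R, and its inner
      radius becomes r / c.\<close>
    define c where "c = 1 + s n"
    have c: "c > 1" using s by (simp add: c_def)
    have i1: "integrable lborel (\<lambda>x. w x / norm x)"
      by (intro integrable_annulus continuous_intros) auto
    have i2: "integrable lborel (\<lambda>x. w (c *\<^sub>R x) / norm x)"
    proof (rule integrable_annulus_support[of _ "r / c" "R"])
      show "continuous_on (- {0}) (\<lambda>x. w (c *\<^sub>R x) / norm x)"
        by (intro continuous_intros) auto
      show "r / c > 0" using r c by simp
      show "w (c *\<^sub>R x) / norm x = 0" if "norm x < r / c" for x
        using that c by (simp add: near field_simps)
      show "w (c *\<^sub>R x) / norm x = 0" if "norm x > R" for x
      proof -
        have "norm x \<le> norm (c *\<^sub>R x)" using c mult_right_mono[of 1 c "norm x"] by simp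
        then show ?thesis using that by (simp add: far)
      qed
    qed
    have "I = \<bar>c\<bar> ^ DIM('a) * (LINT x|lborel. w (0 + c *\<^sub>R x) / norm (0 + c *\<^sub>R x))"
      unfolding I_def by (rule integral_affine_lborel) (use c in auto)
    also have "(LINT x|lborel. w (0 + c *\<^sub>R x) / norm (0 + c *\<^sub>R x)) = (LINT x|lborel. inverse c * (w (c *\<^sub>R x) / norm x))"
      using c by (intro Bochner_Integration.integral_cong) (auto simp: field_simps)
    also have "\<dots> = inverse c * (LINT x|lborel. w (c *\<^sub>R x) / norm x)"
      by (rule integral_mult_right_zero)
    finally have "(LINT x|lborel. w (c *\<^sub>R x) / norm x) = c / c ^ DIM('a) * I"
      using c by (simp add: field_simps)
    note J = this
    have "(LINT x|lborel. q n x) = (LINT x|lborel. inverse (s n) * (w (c *\<^sub>R x) / norm x - w x / norm x))"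
      by (intro Bochner_Integration.integral_cong) (auto simp: q_def c_def divide_inverse algebra_simps)
    also have "\<dots> = inverse (s n) * ((LINT x|lborel. w (c *\<^sub>R x) / norm x) - (LINT x|lborel. w x / norm x))"
      by (subst integral_mult_right_zero, subst Bochner_Integration.integral_diff[OF i2 i1]) (rule refl)
    also have "\<dots> = inverse (s n) * (c / c ^ DIM('a) * I - I)"
      unfolding J I_def ..
    finally show ?thesis by (simp add: c_def divide_inverse algebra_simps)
  qed
  moreover have "(\<lambda>n. ((1 + s n) / (1 + s n) ^ DIM('a) - 1) / s n * I) \<longlonglongrightarrow> (1 - real DIM('a)) * I"
  proof -
    \<comment> \<open>The derivative of t^(1-N) at 1, shifted to 0.\<close>
    have "((\<lambda>t. (1 + t) / (1 + t) ^ DIM('a)) has_field_derivative (1 - real DIM('a))) (at (0::real))"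
      by (auto intro!: derivative_eq_intros)
    then have "((\<lambda>t. ((1 + t) / (1 + t) ^ DIM('a) - 1) / t) \<longlongrightarrow> 1 - real DIM('a)) (at (0::real))"
      by (simp add: DERIV_def)
    from filterlim_compose[OF this s0] show ?thesis by (intro tendsto_mult_right)
  qed
  ultimately show ?thesis using LIMSEQ_unique unfolding I_def by simp
qed

text \<open>The cross term of the expanded energy is the radial derivative of w^2, so
  \<open>radial_derivative_integral\<close> is to be applied to the square.\<close>

lemma C1_annulus_square: "C1_annulus (\<lambda>x. (w x)\<^sup>2) (\<lambda>x. (2 * w x) *\<^sub>R G x) r R"
proof
  show "((\<lambda>x. (w x)\<^sup>2) has_derivative (\<lambda>h. (2 * w x) *\<^sub>R G x \<bullet> h)) (at x)" for x
    by (auto intro!: derivative_eq_intros deriv)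
  show "continuous_on UNIV (\<lambda>x. (2 * w x) *\<^sub>R G x)"
    by (intro continuous_intros) auto
qed (auto simp: near far r)

lemma integrable_basic:
  "integrable lborel (\<lambda>x. (norm (G x))\<^sup>2)" "integrable lborel (\<lambda>x. (w x)\<^sup>2)"
  "integrable lborel (\<lambda>x. (w x)\<^sup>2 / norm x)" "integrable lborel (\<lambda>x. (2 * w x) *\<^sub>R G x \<bullet> x / norm x)"
  by (intro integrable_annulus continuous_intros; auto)+

lemma energy_pointwise:
  "(norm (G x + (b * w x / norm x) *\<^sub>R x))\<^sup>2
    = (norm (G x))\<^sup>2 + b * ((2 * w x) *\<^sub>R G x \<bullet> x / norm x) + b\<^sup>2 * (w x)\<^sup>2"
proof (cases "x = 0")
  \<comment> \<open>At the origin division by zero yields 0, so the cross term drops out, and the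
    term b^2 w(0)^2 vanishes because w(0) = 0.\<close>
  case True
  then show ?thesis using near[of 0] r by simp
next
  case False
  define k where "k = b * w x / norm x"
  have "(norm (G x + k *\<^sub>R x))\<^sup>2 = (norm (G x))\<^sup>2 + 2 * k * (G x \<bullet> x) + k\<^sup>2 * (norm x)\<^sup>2"
    unfolding power2_norm_eq_inner
    by (simp add: inner_add_left inner_add_right inner_commute power2_eq_square algebra_simps)
  also have "k\<^sup>2 * (norm x)\<^sup>2 = b\<^sup>2 * (w x)\<^sup>2"
    using False by (simp add: k_def power_mult_distrib power_divide)
  finally show ?thesis by (simp add: k_def algebra_simps)
qed

text \<open>The parameter b stays arbitrary because two values are used: sqrt(D/L) for the stability
  estimate and C/L for the positivity of D, where D, L and C are the Dirichlet, square and Coulomb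
  integrals.\<close>

lemma energy_identity:
  shows integrable_energy: "integrable lborel (\<lambda>x. (norm (G x + (b * w x / norm x) *\<^sub>R x))\<^sup>2)"
    and "(LINT x|lborel. (norm (G x + (b * w x / norm x) *\<^sub>R x))\<^sup>2)
      = (LINT x|lborel. (norm (G x))\<^sup>2) + b\<^sup>2 * (LINT x|lborel. (w x)\<^sup>2)
        - b * (real DIM('a) - 1) * (LINT x|lborel. (w x)\<^sup>2 / norm x)"
proof -
  show "integrable lborel (\<lambda>x. (norm (G x + (b * w x / norm x) *\<^sub>R x))\<^sup>2)"
    unfolding energy_pointwise
    by (intro Bochner_Integration.integrable_add integrable_mult_right integrable_basic)
  have "(LINT x|lborel. (norm (G x + (b * w x / norm x) *\<^sub>R x))\<^sup>2)
      = (LINT x|lborel. (norm (G x))\<^sup>2) + b * (LINT x|lborel. (2 * w x) *\<^sub>R G x \<bullet> x / norm x)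
        + b\<^sup>2 * (LINT x|lborel. (w x)\<^sup>2)"
  proof -
    define e where "e x = (2 * w x) *\<^sub>R G x \<bullet> x / norm x" for x
    have "integrable lborel e" unfolding e_def by (rule integrable_basic)
    then show ?thesis
      unfolding energy_pointwise e_def[symmetric] using integrable_basic(1,2) by simp
  qed
  also have "(LINT x|lborel. (2 * w x) *\<^sub>R G x \<bullet> x / norm x) = (1 - real DIM('a)) * (LINT x|lborel. (w x)\<^sup>2 / norm x)"
    by (rule C1_annulus.radial_derivative_integral[OF C1_annulus_square])
  finally show "(LINT x|lborel. (norm (G x + (b * w x / norm x) *\<^sub>R x))\<^sup>2)
      = (LINT x|lborel. (norm (G x))\<^sup>2) + b\<^sup>2 * (LINT x|lborel. (w x)\<^sup>2)
        - b * (real DIM('a) - 1) * (LINT x|lborel. (w x)\<^sup>2 / norm x)"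
    by (simp add: algebra_simps)
qed

text \<open>Off the origin this is the product rule. At the origin, where the norm is not
  differentiable, the product is locally zero; continuity of the gradient is glued from the ball of
  radius r and the punctured space.\<close>

lemma C1_field_exp_mult:
  "C1_field (\<lambda>x. w x * exp (b * norm x)) (\<lambda>x. exp (b * norm x) *\<^sub>R (G x + (b * w x / norm x) *\<^sub>R x))"
    (is "C1_field ?v ?V")
proof
  fix x :: 'a
  show "(?v has_derivative (\<lambda>h. ?V x \<bullet> h)) (at x)"
  proof (cases "x = 0")
    case True
    have "(?v has_derivative (\<lambda>_. 0)) (at x)"
      by (rule has_derivative_transform_within_open[OF has_derivative_const, of "ball 0 r"])
         (use True r in \<open>auto simp: near\<close>)
    then show ?thesis using True r by (simp add: near G_near)
  next
    case False
    then show ?thesis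
      by (auto intro!: derivative_eq_intros deriv has_derivative_norm
          simp: inner_add_left sgn_div_norm divide_inverse algebra_simps inner_commute)
  qed
next
  have "continuous_on (ball 0 r) ?V"
    by (rule continuous_on_eq[OF continuous_on_const[of _ 0]]) (auto simp: near G_near)
  moreover have "continuous_on (- {0}) ?V"
    by (intro continuous_intros) auto
  ultimately have "continuous_on (ball 0 r \<union> - {0}) ?V"
    by (intro continuous_on_open_Un) auto
  moreover have "ball 0 r \<union> - {0} = (UNIV :: 'a set)" using r by auto
  ultimately show "continuous_on UNIV ?V" by simp
qed

text \<open>Moving exp(-2b|x|) = exp(-b|x|)^2 inside the squares of \<open>exp_poincare\<close>
  turns w exp(b|x|) - c into w - c exp(-b|x|), and the gradient of the product into the field whose
  energy was just computed.\<close>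

lemma stability_at_scale:
  assumes b: "b > 0"
  shows "\<exists>c. (LINT x|lborel. (w x - c * exp (- b * norm x))\<^sup>2)
    \<le> poincare_const DIM('a) / b\<^sup>2 * ((LINT x|lborel. (norm (G x))\<^sup>2) + b\<^sup>2 * (LINT x|lborel. (w x)\<^sup>2)
        - b * (real DIM('a) - 1) * (LINT x|lborel. (w x)\<^sup>2 / norm x))"
proof -
  let ?V = "\<lambda>x. G x + (b * w x / norm x) *\<^sub>R x"
  obtain c where c: "(\<integral>\<^sup>+x. ennreal ((w x * exp (b * norm x) - c)\<^sup>2 * exp (- 2 * b * norm x)) \<partial>lborel)
    \<le> ennreal (poincare_const DIM('a) / b\<^sup>2) *
      (\<integral>\<^sup>+x. ennreal ((norm (exp (b * norm x) *\<^sub>R ?V x))\<^sup>2 * exp (- 2 * b * norm x)) \<partial>lborel)"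
    using exp_poincare[OF C1_field_exp_mult[of b] b] by blast
  have e: "exp (- 2 * b * norm x) = (exp (- b * norm x))\<^sup>2" for x :: 'a
    by (simp add: power2_eq_square exp_add[symmetric])
  have e1: "exp (b * norm x) * exp (- b * norm x) = 1" for x :: 'a
    by (simp add: exp_add[symmetric])
  have l: "(w x * exp (b * norm x) - c)\<^sup>2 * exp (- 2 * b * norm x) = (w x - c * exp (- b * norm x))\<^sup>2" for x
  proof -
    have "(w x * exp (b * norm x) - c) * exp (- b * norm x) = w x * (exp (b * norm x) * exp (- b * norm x)) - c * exp (- b * norm x)"
      by (simp add: algebra_simps)
    then show ?thesis unfolding e e1 power_mult_distrib[symmetric] by simp
  qed
  have g: "(norm (exp (b * norm x) *\<^sub>R ?V x))\<^sup>2 * exp (- 2 * b * norm x) = (norm (?V x))\<^sup>2" for x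
  proof -
    have "norm (exp (b * norm x) *\<^sub>R ?V x) * exp (- b * norm x) = (exp (b * norm x) * exp (- b * norm x)) * norm (?V x)"
      by (simp only: norm_scaleR abs_exp_cancel mult_ac)
    then show ?thesis unfolding e e1 power_mult_distrib[symmetric] by simp
  qed
  define X where "X = (LINT x|lborel. (norm (?V x))\<^sup>2)"
  define k where "k = poincare_const DIM('a) / b\<^sup>2"
  have k: "k \<ge> 0" using poincare_const_pos[of "DIM('a)"] by (simp add: k_def)
  have X0: "X \<ge> 0" unfolding X_def by simp
  have "(\<integral>\<^sup>+x. ennreal ((norm (?V x))\<^sup>2) \<partial>lborel) = ennreal X"
    unfolding X_def by (rule nn_integral_eq_integral[OF integrable_energy]) simp
  then have "(\<integral>\<^sup>+x. ennreal ((w x - c * exp (- b * norm x))\<^sup>2) \<partial>lborel) \<le> ennreal (k * X)"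
    using c k X0 unfolding l g k_def[symmetric] by (simp add: ennreal_mult)
  then have "enn2real (\<integral>\<^sup>+x. ennreal ((w x - c * exp (- b * norm x))\<^sup>2) \<partial>lborel) \<le> k * X"
    using k X0 by (intro enn2real_leI) auto
  \<comment> \<open>A Bochner integral defaults to 0 when the function is not integrable; the finite
    bound just obtained shows that here it is the true value.\<close>
  moreover have "(LINT x|lborel. (w x - c * exp (- b * norm x))\<^sup>2)
    = enn2real (\<integral>\<^sup>+x. ennreal ((w x - c * exp (- b * norm x))\<^sup>2) \<partial>lborel)"
    by (rule integral_eq_nn_integral) auto
  ultimately have "(LINT x|lborel. (w x - c * exp (- b * norm x))\<^sup>2) \<le> k * X" by simp
  then show ?thesis unfolding X_def energy_identity k_def by (rule exI)
qed

section \<open>Positivity of the energies\<close>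

lemma AE_zero_imp_zero:
  assumes "AE x in lborel. w x = 0"
  shows "w x = 0"
proof -
  have "closed {x. w x = 0}" by (intro closed_Collect_eq cont continuous_on_const)
  moreover have "AE x in lebesgue. x \<in> {x. w x = 0}" using AE_completion[OF assms] by simp
  ultimately show ?thesis using mem_closed_if_AE_lebesgue by blast
qed

lemma positive_energies:
  assumes "w a \<noteq> 0" and "DIM('a) \<ge> 3"
  shows "(LINT x|lborel. (w x)\<^sup>2) > 0" "(LINT x|lborel. (norm (G x))\<^sup>2) > 0"
proof -
  let ?L = "LINT x|lborel. (w x)\<^sup>2" and ?C = "LINT x|lborel. (w x)\<^sup>2 / norm x"
    and ?D = "LINT x|lborel. (norm (G x))\<^sup>2"
  have "?L \<noteq> 0"
  proof
    assume "?L = 0"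
    then have "AE x in lborel. (w x)\<^sup>2 = 0"
      by (subst (asm) integral_nonneg_eq_0_iff_AE[OF integrable_basic(2)]) auto
    then have "AE x in lborel. w x = 0" by simp
    then show False using AE_zero_imp_zero assms(1) by blast
  qed
  then show L: "?L > 0" by (simp add: less_le)
  have "?C \<noteq> 0"
  proof
    assume "?C = 0"
    then have "AE x in lborel. (w x)\<^sup>2 / norm x = 0"
      by (subst (asm) integral_nonneg_eq_0_iff_AE[OF integrable_basic(3)]) auto
    then have "AE x in lborel. w x = 0"
      by (rule AE_mp) (use near[of 0] r in \<open>auto intro!: AE_I2\<close>)
    then show False using AE_zero_imp_zero assms(1) by blast
  qed
  then have C: "?C > 0" by (simp add: less_le)
  show "?D > 0"
  proof (rule ccontr)
    assume D: "\<not> ?D > 0"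
    \<comment> \<open>If D were 0, the identity would give 0 \<le> b^2 L - b (N - 1) C. At b = C/L
      the right side is -b C (N - 2), negative for N \<ge> 3.\<close>
    define b where "b = ?C / ?L"
    have "0 \<le> (LINT x|lborel. (norm (G x + (b * w x / norm x) *\<^sub>R x))\<^sup>2)" by simp
    then have "b * (real DIM('a) - 1) * ?C \<le> b\<^sup>2 * ?L" using D unfolding energy_identity by simp
    also have "b\<^sup>2 * ?L = b * ?C" using L by (simp add: b_def power2_eq_square)
    finally have "b * ?C * (real DIM('a) - 2) \<le> 0" by (simp add: algebra_simps)
    moreover have "b * ?C * (real DIM('a) - 2) > 0"
      using L C assms(2) by (intro mult_pos_pos) (auto simp: b_def)
    ultimately show False by linarith
  qed
qed

end

subsection \<open>Smooth functions supported away from the origin\<close>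

lemma frechet_derivative_eq_grad:
  fixes u :: "real^'n::finite \<Rightarrow> real"
  assumes "u differentiable at x"
  shows "frechet_derivative u (at x) h = grad u x \<bullet> h"
proof -
  have lin: "linear (frechet_derivative u (at x))"
    using assms by (rule linear_frechet_derivative)
  have "frechet_derivative u (at x) h = frechet_derivative u (at x) (\<Sum>i\<in>UNIV. (h $ i) *\<^sub>R axis i 1)"
    using basis_expansion[of h] by (simp add: scalar_mult_eq_scaleR)
  also have "\<dots> = (\<Sum>i\<in>UNIV. h $ i * partial i u x)"
    using lin by (simp add: linear_sum linear_cmul partial_def)
  finally show ?thesis by (simp add: inner_vec_def grad_def mult.commute)
qed

text \<open>Smoothness is given only off the origin, but the compact closure of the support misses
  0: some ball about 0 carries no support, and there u and its gradient vanish. So u is C^1 on the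
  whole space.\<close>

lemma Cc_infinity_C1_annulus:
  fixes u :: "real^'n::finite \<Rightarrow> real"
  assumes "u \<in> Cc_infinity (UNIV - {0})"
  obtains r R where "C1_annulus u (grad u) r R"
proof -
  let ?K = "closure {x. u x \<noteq> 0}"
  have C1: "Ck_on (Suc 0) (UNIV - {0}) u" and K: "compact ?K" "0 \<notin> ?K"
    using assms unfolding Cc_infinity_def smooth_on_def by blast+
  obtain r where r: "r > 0" "ball 0 r \<subseteq> - ?K"
    using K(2) open_contains_ball[of "- ?K"] by (metis Compl_iff closed_closure open_Compl)
  have near: "u x = 0" if "norm x < r" for x
  proof -
    have "x \<notin> ?K" using r(2) that by auto
    then show ?thesis using closure_subset[of "{x. u x \<noteq> 0}"] by blast
  qed
  obtain R where R: "\<And>x. x \<in> ?K \<Longrightarrow> norm x \<le> R"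
    using compact_imp_bounded[OF K(1)] unfolding bounded_iff by blast
  have far: "u x = 0" if "norm x > R" for x
    using R[of x] that closure_subset[of "{x. u x \<noteq> 0}"] by force
  have zero: "(u has_derivative (\<lambda>_. 0)) (at x)" if "norm x < r" for x
    by (rule has_derivative_transform_within_open[OF has_derivative_const, of "ball 0 r"])
       (use that in \<open>auto simp: near\<close>)
  have diff: "u differentiable at x" for x
  proof (cases "x = 0")
    case True
    then show ?thesis using zero[of 0] r by (auto simp: differentiable_def)
  next
    case False
    then show ?thesis using C1 by simp
  qed
  have grad0: "grad u x = 0" if "norm x < r" for x
    unfolding grad_def partial_def frechet_derivative_at[OF zero[OF that], symmetric]
    by (simp add: vec_eq_iff)
  have "C1_annulus u (grad u) r R"
  proof
    show "(u has_derivative (\<lambda>h. grad u x \<bullet> h)) (at x)" for x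
      using diff[of x] frechet_derivative_works[of u "at x"]
      by (simp add: frechet_derivative_eq_grad[OF diff, abs_def, symmetric])
    have "continuous_on (ball 0 r) (grad u)"
      by (rule continuous_on_eq[OF continuous_on_const[of _ 0]]) (auto simp: grad0)
    moreover have "continuous_on (UNIV - {0}) (grad u)"
      using C1 unfolding grad_def[abs_def] by (intro continuous_on_vec_lambda) auto
    ultimately have "continuous_on (ball 0 r \<union> (UNIV - {0})) (grad u)"
      by (intro continuous_on_open_Un) auto
    moreover have "ball 0 r \<union> (UNIV - {0}) = (UNIV :: (real^'n) set)" using r by auto
    ultimately show "continuous_on UNIV (grad u)" by simp
  qed (use near far r in auto)
  then show ?thesis by (rule that)
qed

section \<open>Infima over the exponential family and the final inequality\<close>

lemma INF_divide_right:
  fixes f :: "'b \<Rightarrow> real"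
  assumes L: "L > 0" and "A \<noteq> {}" and "\<And>x. x \<in> A \<Longrightarrow> 0 \<le> f x"
  shows "(INF x\<in>A. f x / L) = (INF x\<in>A. f x) / L"
proof (rule antisym)
  have bdd: "bdd_below (f ` A)" "bdd_below ((\<lambda>x. f x / L) ` A)"
    using assms by (auto intro!: bdd_belowI2[of _ 0])
  have "L * (INF x\<in>A. f x / L) \<le> (INF x\<in>A. f x)"
  proof (rule cINF_greatest[OF assms(2)])
    fix x assume "x \<in> A"
    then have "(INF x\<in>A. f x / L) \<le> f x / L" by (rule cINF_lower[OF bdd(2)])
    then show "L * (INF x\<in>A. f x / L) \<le> f x" using L by (simp add: field_simps)
  qed
  then show "(INF x\<in>A. f x / L) \<le> (INF x\<in>A. f x) / L" using L by (simp add: field_simps)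
  show "(INF x\<in>A. f x) / L \<le> (INF x\<in>A. f x / L)"
    using L by (intro cINF_greatest[OF assms(2)] divide_right_mono cINF_lower[OF bdd(1)]) auto
qed

lemma L2_sq_nonneg: "L2_sq f \<ge> 0"
  unfolding L2_sq_def by simp

lemma M00_eq_image:
  "(M00 :: (real^'n::finite \<Rightarrow> real) set) = (\<lambda>(c, l) x. c * exp (- norm x / l)) ` (UNIV \<times> {0<..})"
  (is "?M = ?S")
proof
  show "?M \<subseteq> ?S"
  proof
    fix v :: "real^'n \<Rightarrow> real" assume "v \<in> ?M"
    then obtain \<alpha> \<beta> where v: "v = (\<lambda>x. \<alpha> * exp (\<beta> * norm x))" "\<beta> < 0" unfolding M00_def by blast
    then have "v = (\<lambda>(c, l) x. c * exp (- norm x / l)) (\<alpha>, - 1 / \<beta>)"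
      by (simp add: mult.commute)
    moreover have "(\<alpha>, - 1 / \<beta>) \<in> UNIV \<times> {0<..}" using v(2) by (simp add: field_simps)
    ultimately show "v \<in> ?S" by (rule image_eqI)
  qed
  show "?S \<subseteq> ?M"
  proof
    fix v :: "real^'n \<Rightarrow> real"
    assume "v \<in> ?S"
    then obtain c l where v: "v = (\<lambda>x. c * exp (- norm x / l))" "l > 0" by auto
    then have "v = (\<lambda>x. c * exp ((- 1 / l) * norm x)) \<and> - 1 / l < 0"
      by (simp add: field_simps)
    then show "v \<in> ?M" unfolding M00_def by blast
  qed
qed

lemma INF_M00:
  fixes u :: "real^'n::finite \<Rightarrow> real"
  assumes "L2_sq u > 0"
  shows "(INF v \<in> M00. L2_sq (\<lambda>x. u x - v x) / L2_sq u)
    = (INF (c, l) \<in> UNIV \<times> {0<..}. L2_sq (\<lambda>x. u x - c * exp (- norm x / l))) / L2_sq u"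
proof -
  have "(INF v \<in> M00. L2_sq (\<lambda>x. u x - v x) / L2_sq u) = (INF v \<in> M00. L2_sq (\<lambda>x. u x - v x)) / L2_sq u"
    by (rule INF_divide_right[OF assms]) (auto simp: L2_sq_nonneg M00_eq_image)
  then show ?thesis
    by (simp add: M00_eq_image image_image case_prod_unfold)
qed

theorem corollary1p5:
  assumes "CARD('n::finite) \<ge> 3"
  shows
    "(\<exists>C>0. \<forall>u \<in> Cc_infinity (UNIV - {0 :: real^'n}) - {\<lambda>_. 0}.
        sqrt (dirichlet_energy u) * sqrt (L2_sq u) - (real CARD('n) - 1) / 2 * coulomb_energy u
          \<ge> C * sqrt (dirichlet_energy u / L2_sq u)
              * (INF (c, l) \<in> UNIV \<times> {0<..}. L2_sq (\<lambda>x. u x - c * exp (- norm x / l)))) \<and>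
     (\<forall>C>0. \<forall>u \<in> Cc_infinity (UNIV - {0 :: real^'n}) - {\<lambda>_. 0}.
        sqrt (dirichlet_energy u) * sqrt (L2_sq u) - (real CARD('n) - 1) / 2 * coulomb_energy u
          \<ge> C * sqrt (dirichlet_energy u / L2_sq u)
              * (INF (c, l) \<in> UNIV \<times> {0<..}. L2_sq (\<lambda>x. u x - c * exp (- norm x / l)))
        \<longleftrightarrow>
        1 - ((real CARD('n) - 1) / 2 * coulomb_energy u) / (sqrt (dirichlet_energy u) * sqrt (L2_sq u))
          \<ge> C * (INF v \<in> M00. L2_sq (\<lambda>x. u x - v x) / L2_sq u))"
proof (intro conjI exI ballI allI impI)
  let ?J = "\<lambda>u::real^'n \<Rightarrow> real. INF (c, l) \<in> UNIV \<times> {0<..}. L2_sq (\<lambda>x. u x - c * exp (- norm x / l))"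
  let ?P = "poincare_const CARD('n)"
  have P: "?P > 0" by (rule poincare_const_pos)
  \<comment> \<open>Stability gives J \<le> (P / b^2) (2 b deficit), that is, deficit \<ge> b J / (2
    P).\<close>
  show "1 / (2 * ?P) > 0" using P by simp
  fix u :: "real^'n \<Rightarrow> real"
  assume u: "u \<in> Cc_infinity (UNIV - {0}) - {\<lambda>_. 0}"
  then obtain r R where "C1_annulus u (grad u) r R" using Cc_infinity_C1_annulus[of u] by blast
  then interpret C1_annulus u "grad u" r R .
  obtain a where "u a \<noteq> 0" using u by auto
  define D where "D = dirichlet_energy u"
  define L where "L = L2_sq u"
  define Co where "Co = coulomb_energy u"
  have DL: "D > 0" "L > 0"
    using positive_energies[OF \<open>u a \<noteq> 0\<close>] assms
    by (auto simp: D_def L_def dirichlet_energy_def L2_sq_def)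
  \<comment> \<open>This b balances the two quadratic terms, D = b^2 L, so that D + b^2 L = 2 b
    sqrt(D) sqrt(L) and the energy becomes exactly 2b times the deficit.\<close>
  define b where "b = sqrt (D / L)"
  have b: "b > 0" using DL by (simp add: b_def)
  have b2: "b\<^sup>2 = D / L" using DL by (simp add: b_def)
  have bP: "b * L = sqrt D * sqrt L"
    using DL by (simp add: b_def real_sqrt_divide field_simps)
  {
    obtain c where c: "(LINT x|lborel. (u x - c * exp (- b * norm x))\<^sup>2)
      \<le> ?P / b\<^sup>2 * (D + b\<^sup>2 * L - b * (real CARD('n) - 1) * Co)"
      using stability_at_scale[OF b]
      by (auto simp: D_def L_def Co_def dirichlet_energy_def L2_sq_def coulomb_energy_def)
    \<comment> \<open>The competitor has lambda = 1/b, matching exp(-b|x|).\<close>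
    have "?J u \<le> L2_sq (\<lambda>x. u x - c * exp (- norm x / (1 / b)))"
      using b by (intro cINF_lower2[where x = "(c, 1 / b)"]) (auto intro!: bdd_belowI2[of _ 0] simp: L2_sq_nonneg)
    also have "\<dots> \<le> ?P / b\<^sup>2 * (D + b\<^sup>2 * L - b * (real CARD('n) - 1) * Co)"
      using c by (simp add: L2_sq_def mult.commute)
    also have "D = b * (b * L)" using DL b2 by (simp add: power2_eq_square field_simps)
    also have "?P / b\<^sup>2 * (b * (b * L) + b\<^sup>2 * L - b * (real CARD('n) - 1) * Co)
      = 2 * ?P / b * (b * L - (real CARD('n) - 1) / 2 * Co)"
      using b by (simp add: power2_eq_square field_simps)
    finally have "1 / (2 * ?P) * b * ?J u \<le> 1 / (2 * ?P) * b * (2 * ?P / b * (b * L - (real CARD('n) - 1) / 2 * Co))"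
      using P b by (intro mult_left_mono) auto
    also have "\<dots> = sqrt D * sqrt L - (real CARD('n) - 1) / 2 * Co"
      using P b bP by simp
    finally show "1 / (2 * ?P) * sqrt (dirichlet_energy u / L2_sq u) * ?J u
      \<le> sqrt (dirichlet_energy u) * sqrt (L2_sq u) - (real CARD('n) - 1) / 2 * coulomb_energy u"
      unfolding b_def D_def L_def Co_def .
  }
  fix C :: real
  \<comment> \<open>The two forms differ by division by b L = sqrt(D) sqrt(L) > 0; on the left this
    cancels b and leaves J / L.\<close>
  have "C * b * ?J u \<le> b * L - (real CARD('n) - 1) / 2 * Co
    \<longleftrightarrow> C * (?J u / L) \<le> 1 - (real CARD('n) - 1) / 2 * Co / (b * L)"
    using b DL by (simp add: field_simps)
  then have "C * b * ?J u \<le> sqrt D * sqrt L - (real CARD('n) - 1) / 2 * Co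
    \<longleftrightarrow> C * (?J u / L) \<le> 1 - (real CARD('n) - 1) / 2 * Co / (sqrt D * sqrt L)"
    unfolding bP .
  moreover have "(INF v \<in> M00. L2_sq (\<lambda>x. u x - v x) / L2_sq u) = ?J u / L2_sq u"
    using DL by (intro INF_M00) (simp add: L_def)
  ultimately show "C * sqrt (dirichlet_energy u / L2_sq u) * ?J u
      \<le> sqrt (dirichlet_energy u) * sqrt (L2_sq u) - (real CARD('n) - 1) / 2 * coulomb_energy u
    \<longleftrightarrow> C * (INF v \<in> M00. L2_sq (\<lambda>x. u x - v x) / L2_sq u)
      \<le> 1 - ((real CARD('n) - 1) / 2 * coulomb_energy u) / (sqrt (dirichlet_energy u) * sqrt (L2_sq u))"
    by (simp only: b_def D_def L_def Co_def)
qed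

end
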